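(* Let $\mathcal{R}=(V,R)$ be the random graph and let $f\in\mathrm{Aut}(\mathcal{R})$ have property $( * )_0$ or property $( * )_1$. Let $N$ be the union of the finite orbits of $f$, and let $\mathcal{K}\subset\mathrm{Aut}(\mathcal{R})$ be a compact set such that $h|_N=f|_N$ for every $h\in\mathcal{K}$. Then $\mathcal{K}$ can be translated into the conjugacy class of $f$. In fact, there exist $g\in\mathrm{Aut}(\mathcal{R})$ and $\phi_h\in\mathrm{Aut}(\mathcal{R})$ for $h\in\mathcal{K}$ such that $g|_N=\phi_h|_N=\mathrm{id}_N$ and $\phi_h\circ h\circ g=f\circ\phi_h$ for every $h\in\mathcal{K}$.
   Context: The random graph $\mathcal{R}=(V,R)$ is the unique countable graph such that for every pair of finite disjoint $A,B\subset V$ there is $v$ with $xRv$ for $x\in A$ and $\neg(yRv)$ for $y\in B$; $\mathrm{Aut}(\mathcal{R})$ carries the topology of pointwise convergence. For $f\in\mathrm{Aut}(\mathcal{R})$ and $A\subset V$, $\mathcal{O}^f(A)=\{f^k(v):v\in A,k\in\mathbb{Z}\}$. For finite $M\subset V$ and $\tau:M\to\{0,1\}$, a vertex $v$ realizes $\tau$ if for every $w\in M$: $wRv\iff\tau(w)=1$. An automorphism $f$ has property $( * )_0$ (resp. $( * )_1$) if $f$ has only finitely many finite orbits and infinitely many infinite orbits, and for every finite $M\subset V$ and $\tau:M\to\{0,1\}$ there exists $v$ that realizes $\tau$ with $v\notin\mathcal{O}^f(M)$ and $\neg(vRf(v))$ (resp. $vRf(v)$). *)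

theory Defs
  imports "HOL-Analysis.Analysis"
begin

text \<open>The vertex set is the whole type \<open>'v\<close>. The extension axiom forces it to be infinite.\<close>

locale random_graph =
  fixes R :: "'v \<Rightarrow> 'v \<Rightarrow> bool"
  assumes countable_vertices: "countable (UNIV :: 'v set)"
    and symmetric: "symp R"
    and irreflexive: "irreflp R"
    and extension: "\<And>A B. finite A \<Longrightarrow> finite B \<Longrightarrow> A \<inter> B = {} \<Longrightarrow>
      \<exists>v. (\<forall>x\<in>A. R x v) \<and> (\<forall>y\<in>B. \<not> R y v)"

definition Aut :: "('v \<Rightarrow> 'v \<Rightarrow> bool) \<Rightarrow> ('v \<Rightarrow> 'v) set" where
  "Aut R = {f. bij f \<and> (\<forall>x y. R (f x) (f y) \<longleftrightarrow> R x y)}"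

text \<open>Pointwise convergence refers to the discrete topology on the vertices.\<close>

definition Aut_topology :: "('v \<Rightarrow> 'v \<Rightarrow> bool) \<Rightarrow> ('v \<Rightarrow> 'v) topology" where
  "Aut_topology R =
    subtopology (product_topology (\<lambda>_. discrete_topology UNIV) UNIV) (Aut R)"

text \<open>Integer iterates; meaningful only for bijections.\<close>

definition int_iterate :: "('v \<Rightarrow> 'v) \<Rightarrow> int \<Rightarrow> 'v \<Rightarrow> 'v" where
  "int_iterate f k = (if 0 \<le> k then f ^^ nat k else inv f ^^ nat (- k))"

definition orbit_of_set :: "('v \<Rightarrow> 'v) \<Rightarrow> 'v set \<Rightarrow> 'v set" where
  "orbit_of_set f A = {int_iterate f k v | v k. v \<in> A}"

definition orbits :: "('v \<Rightarrow> 'v) \<Rightarrow> 'v set set" where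
  "orbits f = {orbit_of_set f {v} | v. True}"

definition finite_orbits_union :: "('v \<Rightarrow> 'v) \<Rightarrow> 'v set" where
  "finite_orbits_union f = \<Union> {C \<in> orbits f. finite C}"

text \<open>A map \<open>\<tau> : M \<rightarrow> {0,1}\<close> is represented by a total boolean function of which only the
  values on \<open>M\<close> are used.\<close>

definition realizes :: "('v \<Rightarrow> 'v \<Rightarrow> bool) \<Rightarrow> 'v set \<Rightarrow> ('v \<Rightarrow> bool) \<Rightarrow> 'v \<Rightarrow> bool" where
  "realizes R M \<tau> v \<longleftrightarrow> (\<forall>w\<in>M. R w v \<longleftrightarrow> \<tau> w)"

text \<open>Property \<open>(*)\<^sub>0\<close> is the case \<open>i = False\<close>, property \<open>(*)\<^sub>1\<close> the case \<open>i = True\<close>.\<close>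

definition star_property :: "('v \<Rightarrow> 'v \<Rightarrow> bool) \<Rightarrow> bool \<Rightarrow> ('v \<Rightarrow> 'v) \<Rightarrow> bool" where
  "star_property R i f \<longleftrightarrow>
    finite {C \<in> orbits f. finite C} \<and>
    infinite {C \<in> orbits f. infinite C} \<and>
    (\<forall>M \<tau>. finite M \<longrightarrow>
      (\<exists>v. realizes R M \<tau> v \<and> v \<notin> orbit_of_set f M \<and> (R v (f v) \<longleftrightarrow> i)))"

definition conjugacy_class :: "('v \<Rightarrow> 'v \<Rightarrow> bool) \<Rightarrow> ('v \<Rightarrow> 'v) \<Rightarrow> ('v \<Rightarrow> 'v) set" where
  "conjugacy_class R f = {\<psi> \<circ> f \<circ> inv \<psi> | \<psi>. \<psi> \<in> Aut R}"

text \<open>Two-sided translation, as in the definition of Haar null sets in a non-abelian group.\<close>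

definition translatable_into ::
  "('v \<Rightarrow> 'v \<Rightarrow> bool) \<Rightarrow> ('v \<Rightarrow> 'v) set \<Rightarrow> ('v \<Rightarrow> 'v) set \<Rightarrow> bool" where
  "translatable_into R K C \<longleftrightarrow>
    (\<exists>g1\<in>Aut R. \<exists>g2\<in>Aut R. (\<lambda>h. g1 \<circ> h \<circ> g2) ` K \<subseteq> C)"

end

theory Submission
  imports Defs
begin

text \<open>
  Compactness is only used to make \<open>K\<close> pointwise finite: all sets \<open>{h v | h \<in> K}\<close> and
  \<open>{inv h v | h \<in> K}\<close> are finite. Both \<open>g\<close> and the conjugating maps \<open>\<phi> h\<close> are unions of finite partial
  isomorphisms, built by back-and-forth for all \<open>h \<in> K\<close> at once. A new value \<open>w\<close> of \<open>g\<close> at \<open>v\<close> forces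
  \<open>\<phi> h (h w) = f (\<phi> h v)\<close> for every \<open>h\<close>, so every \<open>h\<close> prescribes adjacencies of \<open>w\<close>, and these
  prescriptions must not contradict each other. Two facts keep them consistent. First, \<open>w\<close> can be chosen
  such that \<open>h w = h' w\<close> only if \<open>h\<close> and \<open>h'\<close>, and their inverses, agree on everything used so far;
  then \<open>\<phi> h\<close> and \<open>\<phi> h'\<close> agree so far, too. Second, when a vertex \<open>x\<close> is added to the domain of \<open>\<phi> h\<close>,
  its image \<open>p\<close> is provided by the property of \<open>f\<close>: the adjacencies of \<open>p\<close> to the finitely many relevant
  vertices can be prescribed, and whether \<open>p\<close> is adjacent to \<open>f p\<close> is the same for all \<open>h\<close>.
\<close>

subsection \<open>Automorphisms of the random graph\<close>

text \<open>Inverses are compared as well, so that the relation is unaffected by passing to inverse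
  maps, and so that agreement on \<open>P h\<close> also tells which \<open>y\<close> have
  \<open>h y\<close> in \<open>P h\<close>.\<close>

definition agree :: "'v set \<Rightarrow> ('v \<Rightarrow> 'v) \<Rightarrow> ('v \<Rightarrow> 'v) \<Rightarrow> bool" where
  "agree F h h' \<longleftrightarrow> (\<forall>u\<in>F. h u = h' u \<and> inv h u = inv h' u)"

lemma agree_sym: "agree F h h' \<Longrightarrow> agree F h' h"
  by (simp add: agree_def)

lemma agree_trans: "agree F h h' \<Longrightarrow> agree F h' h'' \<Longrightarrow> agree F h h''"
  by (simp add: agree_def)

lemma agree_mono: "agree F h h' \<Longrightarrow> F' \<subseteq> F \<Longrightarrow> agree F' h h'"
  by (auto simp: agree_def)

lemma Aut_bij: "h \<in> Aut R \<Longrightarrow> bij h"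
  by (simp add: Aut_def)

lemma Aut_rel: "h \<in> Aut R \<Longrightarrow> R (h x) (h y) \<longleftrightarrow> R x y"
  by (simp add: Aut_def)

lemma Aut_inv_left: "h \<in> Aut R \<Longrightarrow> inv h (h x) = x"
  by (simp add: Aut_bij bij_is_inj)

lemma Aut_inv_right: "h \<in> Aut R \<Longrightarrow> h (inv h x) = x"
  by (simp add: Aut_bij bij_is_surj surj_f_inv_f)

lemma Aut_eq_iff: "h \<in> Aut R \<Longrightarrow> h x = h y \<longleftrightarrow> x = y"
  by (simp add: Aut_bij bij_is_inj inj_eq)

lemma Aut_inv:
  assumes "h \<in> Aut R"
  shows "inv h \<in> Aut R"
proof -
  have "R (inv h x) (inv h y) \<longleftrightarrow> R x y" for x y
    using Aut_rel[OF assms, of "inv h x" "inv h y"] by (simp add: Aut_inv_right[OF assms])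
  then show ?thesis
    using Aut_bij[OF assms] by (simp add: Aut_def bij_imp_bij_inv)
qed

lemma Aut_rel_left: "h \<in> Aut R \<Longrightarrow> R (h x) y \<longleftrightarrow> R x (inv h y)"
  using Aut_rel[of h R x "inv h y"] by (simp add: Aut_inv_right)

lemma Aut_funpow_eq_iff: "f \<in> Aut R \<Longrightarrow> (f ^^ k) x = (f ^^ k) y \<longleftrightarrow> x = y"
  by (induction k) (auto simp: Aut_eq_iff)

lemma Aut_funpow_inv: "f \<in> Aut R \<Longrightarrow> (inv f ^^ k) x = y \<longleftrightarrow> x = (f ^^ k) y"
proof (induction k arbitrary: x y)
  case (Suc k)
  have "(inv f ^^ Suc k) x = y \<longleftrightarrow> inv f ((inv f ^^ k) x) = y" by simp
  also have "\<dots> \<longleftrightarrow> (inv f ^^ k) x = f y"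
    using Aut_inv_left[OF Suc.prems] Aut_inv_right[OF Suc.prems] by metis
  also have "\<dots> \<longleftrightarrow> x = (f ^^ Suc k) y"
    using Suc by (simp add: funpow_swap1)
  finally show ?case .
qed auto

lemma (in random_graph) realize_avoiding:
  assumes "finite X" 
  shows "\<exists>w. w \<notin> X \<and> (\<forall>y\<in>X. R y w \<longleftrightarrow> \<tau> y)"
proof -
  obtain a where a: "\<forall>y\<in>X. R y a"
    using extension[of X "{}"] assms by auto
  then have "a \<notin> X"
    using irreflexive by (auto simp: irreflp_def)
  \<comment> \<open>Non-adjacency to \<open>a\<close> keeps \<open>w\<close> out of \<open>X\<close>.\<close>
  then have "{y\<in>X. \<tau> y} \<inter> insert a {y\<in>X. \<not> \<tau> y} = {}"
    by auto
  then obtain w where w: "\<forall>y\<in>{y\<in>X. \<tau> y}. R y w" "\<forall>y\<in>insert a {y\<in>X. \<not> \<tau> y}. \<not> R y w"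
    using extension[of "{y\<in>X. \<tau> y}" "insert a {y\<in>X. \<not> \<tau> y}"] assms by auto
  have "w \<notin> X"
    using w a symmetric by (auto simp: symp_def)
  then show ?thesis using w by auto
qed

subsection \<open>Splitting a pointwise finite family\<close>

text \<open>All that is kept of the theorem's hypotheses, phrased with natural iterates only. The
  list is stable under replacing \<open>f\<close> and the members of \<open>K\<close> by their
  inverses.\<close>

locale setting = random_graph R
  for R :: "'v \<Rightarrow> 'v \<Rightarrow> bool" +
  fixes f :: "'v \<Rightarrow> 'v" and i :: bool and N :: "'v set" and K :: "('v \<Rightarrow> 'v) set"
  assumes f_Aut: "f \<in> Aut R"
    and finite_N: "finite N"
    and f_N: "f ` N = N"
    and periodic: "(f ^^ Suc k) p = p \<Longrightarrow> p \<in> N"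
    and star: "finite M \<Longrightarrow> \<exists>v. (\<forall>w\<in>M. R w v \<longleftrightarrow> \<tau> w) \<and>
      (\<forall>w\<in>M. \<forall>k. (f ^^ k) w \<noteq> v \<and> (f ^^ k) v \<noteq> w) \<and> (R v (f v) \<longleftrightarrow> i)"
    and K_Aut: "h \<in> K \<Longrightarrow> h \<in> Aut R"
    and K_N: "h \<in> K \<Longrightarrow> v \<in> N \<Longrightarrow> h v = f v"
    and finite_images: "finite ((\<lambda>h. h v) ` K)"
    and finite_preimages: "finite ((\<lambda>h. inv h v) ` K)"
begin

lemmas f_simps = Aut_inv_left[OF f_Aut] Aut_inv_right[OF f_Aut] Aut_eq_iff[OF f_Aut]
  Aut_rel[OF f_Aut]

lemmas f_bij = Aut_bij[OF f_Aut]

lemmas K_bij = Aut_bij[OF K_Aut]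

lemmas K_simps = Aut_inv_left[OF K_Aut] Aut_inv_right[OF K_Aut] Aut_eq_iff[OF K_Aut]
  Aut_rel[OF K_Aut]

lemma rel_commute: "R x y \<longleftrightarrow> R y x"
  using symmetric by (auto simp: symp_def)

lemma not_refl: "\<not> R x x"
  using irreflexive by (auto simp: irreflp_def)

lemma inv_f_N: "v \<in> N \<Longrightarrow> inv f v \<in> N"
  using f_N f_simps by (metis imageE)

lemma f_in_N: "v \<in> N \<Longrightarrow> f v \<in> N"
  using f_N by blast

lemma inv_K_N: "h \<in> K \<Longrightarrow> v \<in> N \<Longrightarrow> inv h v = inv f v"
  by (metis K_N K_simps(1) f_simps(2) inv_f_N)

definition images :: "'v set \<Rightarrow> 'v set" where
  "images A = (\<Union>h\<in>K. h ` A)"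

definition preimages :: "'v set \<Rightarrow> 'v set" where
  "preimages A = (\<Union>h\<in>K. inv h ` A)"

lemma finite_images_set: "finite A \<Longrightarrow> finite (images A)"
proof -
  assume "finite A"
  moreover have "images A = (\<Union>v\<in>A. (\<lambda>h. h v) ` K)"
    by (auto simp: images_def)
  ultimately show ?thesis using finite_images by simp
qed

lemma finite_preimages_set: "finite A \<Longrightarrow> finite (preimages A)"
proof -
  assume "finite A"
  moreover have "preimages A = (\<Union>v\<in>A. (\<lambda>h. inv h v) ` K)"
    by (auto simp: preimages_def)
  ultimately show ?thesis using finite_preimages by simp
qed

lemma imagesI: "h \<in> K \<Longrightarrow> a \<in> A \<Longrightarrow> h a \<in> images A"
  by (auto simp: images_def)

lemma preimagesI: "h \<in> K \<Longrightarrow> a \<in> A \<Longrightarrow> inv h a \<in> preimages A"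
  by (auto simp: preimages_def)

text \<open>The points of \<open>F\<close> are coded one by one into a single vertex:
  \<open>a\<close> becomes the only neighbour of \<open>b\<close> in \<open>Y\<close>, and
  \<open>b\<close> the only neighbour of \<open>w\<close> in \<open>Z\<close>. If
  \<open>h w = h' w\<close>, the automorphism \<open>inv h' \<circ> h\<close> fixes
  \<open>w\<close>, hence fixes \<open>b\<close>, hence fixes \<open>a\<close>.\<close>

lemma splitting_aux:
  assumes "finite F" "finite X"
  shows "\<exists>w. w \<notin> X \<and> (\<forall>y\<in>X. R y w \<longleftrightarrow> \<tau> y) \<and>
    (\<forall>h\<in>K. \<forall>h'\<in>K. h w = h' w \<longrightarrow> (\<forall>a\<in>F. h a = h' a))"
  using assms
proof (induction F arbitrary: X \<tau> rule: finite_induct)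
  case empty
  then show ?case using realize_avoiding by simp
next
  case (insert a F)
  \<comment> \<open>The first set contains every candidate \<open>inv h' (h a)\<close>. The last one
    keeps all \<open>inv h (h' b)\<close> out of \<open>X\<close>.\<close>
  define Y where "Y = preimages (images {a}) \<union> insert a X \<union> preimages (images X)"
  have "finite Y"
    using insert.prems by (simp add: Y_def finite_images_set finite_preimages_set)
  then obtain b where b: "b \<notin> Y" "\<forall>y\<in>Y. R y b \<longleftrightarrow> y = a"
    "\<And>h h'. h \<in> K \<Longrightarrow> h' \<in> K \<Longrightarrow> h b = h' b \<Longrightarrow> \<forall>a\<in>F. h a = h' a"
    using insert.IH[of Y "\<lambda>y. y = a"] by blast
  have moved: "h a = h' a" if h: "h \<in> K" "h' \<in> K" "h b = h' b" for h h'
  proof -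
    have "R a b" using b(2) by (simp add: Y_def)
    then have "R (inv h' (h a)) (inv h' (h b))"
      using h(1,2) by (simp add: Aut_rel[OF Aut_inv[OF K_Aut]] K_simps)
    then have "R (inv h' (h a)) b"
      using h by (simp add: K_simps)
    moreover have "inv h' (h a) \<in> Y"
      using h by (simp add: Y_def preimagesI imagesI)
    ultimately have "inv h' (h a) = a" using b(2) by blast
    then show ?thesis using h K_simps by metis
  qed
  define Z where "Z = preimages (images {b})"
  \<comment> \<open>Thus coding \<open>b\<close> on \<open>Z\<close> does not clash with the
    prescription \<open>\<tau>\<close> on \<open>X\<close>.\<close>
  have b_Z: "z \<notin> X" if z: "z \<in> insert b Z" for z
  proof
    assume "z \<in> X"
    then have "z \<noteq> b" using b(1) by (auto simp: Y_def)
    then obtain h h' where h: "h \<in> K" "h' \<in> K" "z = inv h (h' b)"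
      using z by (auto simp: Z_def images_def preimages_def)
    then have "inv h' (h z) = b" by (simp add: K_simps)
    moreover have "inv h' (h z) \<in> preimages (images X)"
      using h(1,2) \<open>z \<in> X\<close> by (simp add: preimagesI imagesI)
    ultimately have "b \<in> preimages (images X)" by simp
    then show False using b(1) by (simp add: Y_def)
  qed
  have "finite (X \<union> insert b Z)"
    using insert.prems by (simp add: Z_def finite_images_set finite_preimages_set)
  then obtain w where w: "w \<notin> X \<union> insert b Z"
    "\<forall>y\<in>X \<union> insert b Z. R y w \<longleftrightarrow> (if y \<in> X then \<tau> y else y = b)"
    using realize_avoiding[of "X \<union> insert b Z" "\<lambda>y. if y \<in> X then \<tau> y else y = b"] by auto
  have "h b = h' b" if h: "h \<in> K" "h' \<in> K" "h w = h' w" for h h'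
  proof -
    have "R b w" using w(2) b_Z by auto
    then have "R (inv h' (h b)) (inv h' (h w))"
      using h(1,2) by (simp add: Aut_rel[OF Aut_inv[OF K_Aut]] K_simps)
    then have "R (inv h' (h b)) w"
      using h by (simp add: K_simps)
    moreover have "inv h' (h b) \<in> Z"
      using h by (simp add: Z_def preimagesI imagesI)
    ultimately have "inv h' (h b) = b" using w(2) b_Z by auto
    then show ?thesis using h K_simps by metis
  qed
  then have "\<forall>h\<in>K. \<forall>h'\<in>K. h w = h' w \<longrightarrow> (\<forall>a\<in>insert a F. h a = h' a)"
    using moved b(3) by blast
  moreover have "w \<notin> X \<and> (\<forall>y\<in>X. R y w \<longleftrightarrow> \<tau> y)"
    using w by auto
  ultimately show ?case by blast
qed

text \<open>Separating \<open>preimages F\<close> too controls the inverses: if \<open>h\<close> and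
  \<open>h'\<close> agree at \<open>inv h u\<close>, then \<open>inv h u = inv h' u\<close>.\<close>

lemma splitting:
  assumes "finite F" "finite X"
  obtains w where "w \<notin> X" "\<And>y. y \<in> X \<Longrightarrow> R y w \<longleftrightarrow> \<tau> y"
    "\<And>h h'. h \<in> K \<Longrightarrow> h' \<in> K \<Longrightarrow> h w = h' w \<Longrightarrow> agree F h h'"
proof -
  have fin: "finite (F \<union> preimages F)"
    using assms by (simp add: finite_preimages_set)
  obtain w where w: "w \<notin> X" "\<forall>y\<in>X. R y w \<longleftrightarrow> \<tau> y"
    "\<forall>h\<in>K. \<forall>h'\<in>K. h w = h' w \<longrightarrow> (\<forall>a\<in>F \<union> preimages F. h a = h' a)"
    using splitting_aux[OF fin assms(2), of \<tau>] by blast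
  have "agree F h h'" if h: "h \<in> K" "h' \<in> K" "h w = h' w" for h h'
    unfolding agree_def
  proof
    fix u assume "u \<in> F"
    then have "h u = h' u" "h (inv h u) = h' (inv h u)"
      using w(3) h preimagesI by blast+
    then show "h u = h' u \<and> inv h u = inv h' u"
      using h K_simps by metis
  qed
  then show thesis using w that by blast
qed

text \<open>Provides the mirror image of each extension step. The value \<open>i\<close> survives
  because applying \<open>f\<close> turns adjacency of \<open>v\<close> and \<open>inv f v\<close>
  into adjacency of \<open>f v\<close> and \<open>v\<close>.\<close>

lemma dual_setting: "setting R (inv f) i N (inv ` K)"
proof
  show "inv f \<in> Aut R" using f_Aut by (rule Aut_inv)
  show "finite N" by (rule finite_N)
  show "inv f ` N = N" using f_N by (metis Aut_bij f_Aut bij_is_inj image_inv_f_f)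
  show "p \<in> N" if "(inv f ^^ Suc k) p = p" for k p
    using that periodic[of k p] Aut_funpow_inv[OF f_Aut, of "Suc k" p p] by simp
  show "\<exists>v. (\<forall>w\<in>M. R w v \<longleftrightarrow> \<tau> w) \<and>
      (\<forall>w\<in>M. \<forall>k. (inv f ^^ k) w \<noteq> v \<and> (inv f ^^ k) v \<noteq> w) \<and> (R v (inv f v) \<longleftrightarrow> i)"
    if M: "finite M" for M \<tau>
  proof -
    obtain v where v: "\<forall>w\<in>M. R w v \<longleftrightarrow> \<tau> w"
      "\<forall>w\<in>M. \<forall>k. (f ^^ k) w \<noteq> v \<and> (f ^^ k) v \<noteq> w" "R v (f v) \<longleftrightarrow> i"
      using star[OF M] by blast
    have "R v (inv f v) \<longleftrightarrow> i"
      using v(3) f_simps rel_commute by metis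
    moreover have "\<forall>w\<in>M. \<forall>k. (inv f ^^ k) w \<noteq> v \<and> (inv f ^^ k) v \<noteq> w"
      using v(2) Aut_funpow_inv[OF f_Aut] by metis
    ultimately show ?thesis using v(1) by blast
  qed
  show "h \<in> Aut R" if "h \<in> inv ` K" for h
    using that K_Aut Aut_inv by blast
  show "h v = inv f v" if "h \<in> inv ` K" "v \<in> N" for h v
    using that inv_K_N by blast
  show "finite ((\<lambda>h. h v) ` inv ` K)" for v
    using finite_preimages[of v] by (simp add: image_image)
  have "(\<lambda>h. inv h v) ` inv ` K = (\<lambda>h. h v) ` K" for v
    by (simp add: image_image inv_inv_eq K_bij)
  then show "finite ((\<lambda>h. inv h v) ` inv ` K)" for v
    using finite_images[of v] by simp
qed

end

subsection \<open>Finite stages\<close>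

text \<open>The partial map \<open>\<phi> h\<close> depends only on finitely much information about
  \<open>h\<close>. As \<open>F\<close> contains the preimages of \<open>P h\<close>, every
  \<open>y\<close> with \<open>h y\<close> in \<open>P h\<close> lies in \<open>F\<close>.\<close>

definition controls ::
  "('v \<Rightarrow> 'v) set \<Rightarrow> (('v \<Rightarrow> 'v) \<Rightarrow> 'v set) \<Rightarrow> (('v \<Rightarrow> 'v) \<Rightarrow> 'v \<Rightarrow> 'v) \<Rightarrow> 'v set \<Rightarrow> bool" where
  "controls K P \<phi> F \<longleftrightarrow> finite F \<and> (\<forall>h\<in>K. P h \<subseteq> F \<and> inv h ` P h \<subseteq> F) \<and>
    (\<forall>h\<in>K. \<forall>h'\<in>K. agree F h h' \<longrightarrow> P h = P h' \<and> (\<forall>u\<in>P h. \<phi> h u = \<phi> h' u))"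

definition extends ::
  "('v \<Rightarrow> 'v) set \<Rightarrow> 'v set \<Rightarrow> ('v \<Rightarrow> 'v) \<Rightarrow> (('v \<Rightarrow> 'v) \<Rightarrow> 'v set) \<Rightarrow> (('v \<Rightarrow> 'v) \<Rightarrow> 'v \<Rightarrow> 'v) \<Rightarrow>
    'v set \<Rightarrow> ('v \<Rightarrow> 'v) \<Rightarrow> (('v \<Rightarrow> 'v) \<Rightarrow> 'v set) \<Rightarrow> (('v \<Rightarrow> 'v) \<Rightarrow> 'v \<Rightarrow> 'v) \<Rightarrow> bool" where
  "extends K D g P \<phi> D' g' P' \<phi>' \<longleftrightarrow> D \<subseteq> D' \<and> (\<forall>v\<in>D. g' v = g v) \<and>
    (\<forall>h\<in>K. P h \<subseteq> P' h \<and> (\<forall>u\<in>P h. \<phi>' h u = \<phi> h u))"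

lemma extends_refl: "extends K D g P \<phi> D g P \<phi>"
  by (simp add: extends_def)

lemma extends_trans:
  assumes "extends K D g P \<phi> D' g' P' \<phi>'" "extends K D' g' P' \<phi>' D'' g'' P'' \<phi>''"
  shows "extends K D g P \<phi> D'' g'' P'' \<phi>''"
  using assms unfolding extends_def by (simp add: subset_iff)

text \<open>\<open>P h\<close> is the domain of \<open>\<phi> h\<close>, and \<open>D\<close> that of \<open>g\<close>. Only the values on these domains matter.\<close>

locale stage = setting R f i N K
  for R :: "'v \<Rightarrow> 'v \<Rightarrow> bool" and f i N K +
  fixes D :: "'v set" and g :: "'v \<Rightarrow> 'v"
    and P :: "('v \<Rightarrow> 'v) \<Rightarrow> 'v set" and \<phi> :: "('v \<Rightarrow> 'v) \<Rightarrow> 'v \<Rightarrow> 'v"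
    and c :: "'v \<Rightarrow> 'v \<Rightarrow> bool"
  assumes finite_D: "finite D"
    and N_D: "N \<subseteq> D"
    and g_N: "v \<in> N \<Longrightarrow> g v = v"
    and g_inj: "inj_on g D"
    and g_rel: "u \<in> D \<Longrightarrow> v \<in> D \<Longrightarrow> R (g u) (g v) \<longleftrightarrow> R u v"
    and \<phi>_N: "h \<in> K \<Longrightarrow> v \<in> N \<Longrightarrow> \<phi> h v = v"
    and \<phi>_inj: "h \<in> K \<Longrightarrow> inj_on (\<phi> h) (P h)"
    and \<phi>_rel: "h \<in> K \<Longrightarrow> u \<in> P h \<Longrightarrow> v \<in> P h \<Longrightarrow> R (\<phi> h u) (\<phi> h v) \<longleftrightarrow> R u v"
    and D_P: "h \<in> K \<Longrightarrow> D \<subseteq> P h"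
    and hg_P: "h \<in> K \<Longrightarrow> v \<in> D \<Longrightarrow> h (g v) \<in> P h"
    and equivariant: "h \<in> K \<Longrightarrow> v \<in> D \<Longrightarrow> \<phi> h (h (g v)) = f (\<phi> h v)"
    \<comment> \<open>The range of \<open>\<phi> h\<close> meets each \<open>f\<close>-orbit without
      gaps, and its links are exactly the instances of the equation already imposed. In particular,
      for \<open>v\<close> in \<open>P h\<close> outside \<open>D\<close>, no later iterate of
      \<open>\<phi> h v\<close> is in the range.\<close>
    and orbit_source: "h \<in> K \<Longrightarrow> u \<in> P h \<Longrightarrow> v \<in> P h \<Longrightarrow> \<phi> h u = (f ^^ Suc k) (\<phi> h v) \<Longrightarrow> v \<in> D"
    and orbit_target: "h \<in> K \<Longrightarrow> u \<in> P h \<Longrightarrow> v \<in> P h \<Longrightarrow> \<phi> h u = (f ^^ Suc k) (\<phi> h v) \<Longrightarrow>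
      inv h u \<in> g ` D"
    and controlled: "\<exists>F. controls K P \<phi> F"
    \<comment> \<open>If \<open>g\<close> is later extended at \<open>v\<close> by \<open>w\<close>, every \<open>h\<close> prescribes whether \<open>w\<close> is adjacent
      to a given \<open>y\<close>; these prescriptions must not depend on \<open>h\<close>.\<close>
    and coherent: "h \<in> K \<Longrightarrow> v \<in> P h \<Longrightarrow> v \<notin> D \<Longrightarrow> h y \<in> P h \<Longrightarrow> y \<notin> g ` D \<Longrightarrow>
      R (f (\<phi> h v)) (\<phi> h (h y)) \<longleftrightarrow> c v y"
    \<comment> \<open>If \<open>h y\<close> is added to \<open>P h\<close>, its image \<open>p\<close> satisfies \<open>R p (f p) \<longleftrightarrow> i\<close>, and no other choice is
      available.\<close>
    and default: "h \<in> K \<Longrightarrow> h y \<notin> P h \<Longrightarrow> c (h y) y = i"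
begin

lemma orbit_source_0: "h \<in> K \<Longrightarrow> u \<in> P h \<Longrightarrow> v \<in> P h \<Longrightarrow> \<phi> h u = f (\<phi> h v) \<Longrightarrow> v \<in> D"
  using orbit_source[of h u v 0] by simp

lemma orbit_target_0:
  "h \<in> K \<Longrightarrow> h y \<in> P h \<Longrightarrow> v \<in> P h \<Longrightarrow> \<phi> h (h y) = f (\<phi> h v) \<Longrightarrow> y \<in> g ` D"
  using orbit_target[of h "h y" v 0] by (simp add: K_simps)

lemma finite_P: "h \<in> K \<Longrightarrow> finite (P h)"
  using controlled finite_subset unfolding controls_def by metis

lemma N_P: "h \<in> K \<Longrightarrow> N \<subseteq> P h"
  using N_D D_P by blast

text \<open>Collects what the stage invariants demand of an image \<open>p\<close> of
  \<open>x\<close> while \<open>c\<close> stays fixed. In \<open>coherent\<close>, \<open>x\<close>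
  may become the vertex outside \<open>D\<close>, or the vertex \<open>h y\<close>, or both; the
  last three conjuncts serve these cases.\<close>

definition admissible :: "'v \<Rightarrow> ('v \<Rightarrow> 'v) \<Rightarrow> 'v \<Rightarrow> bool" where
  "admissible x h p \<longleftrightarrow> (\<forall>u\<in>P h. R (\<phi> h u) p \<longleftrightarrow> R u x) \<and>
    (\<forall>u\<in>P h. \<forall>k. (f ^^ k) (\<phi> h u) \<noteq> p \<and> (f ^^ k) p \<noteq> \<phi> h u) \<and>
    (R p (f p) \<longleftrightarrow> i) \<and>
    (\<forall>y. h y \<in> P h \<longrightarrow> y \<notin> g ` D \<longrightarrow> (R (f p) (\<phi> h (h y)) \<longleftrightarrow> c x y)) \<and>
    (\<forall>v\<in>P h - D. R (f (\<phi> h v)) p \<longleftrightarrow> c v (inv h x))"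

text \<open>Since adjacency of \<open>f p\<close> to \<open>z\<close> is adjacency of
  \<open>p\<close> to \<open>inv f z\<close>, everything is a prescription for \<open>p\<close> on
  the finite set \<open>M\<close>. The orbit invariants forbid coincidences between the three kinds
  of constrained vertices, so the prescription is consistent.\<close>

lemma admissible_exists:
  assumes h: "h \<in> K"
  shows "\<exists>p. admissible x h p"
proof -
  define M where "M = \<phi> h ` P h \<union> f ` \<phi> h ` P h \<union> inv f ` \<phi> h ` P h"
  define \<tau> where "\<tau> z \<longleftrightarrow> (\<exists>u\<in>P h. z = \<phi> h u \<and> R u x) \<or>
    (\<exists>v\<in>P h - D. z = f (\<phi> h v) \<and> c v (inv h x)) \<or>
    (\<exists>y. h y \<in> P h \<and> y \<notin> g ` D \<and> f z = \<phi> h (h y) \<and> c x y)" for z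
  have inj: "\<phi> h u = \<phi> h v \<longleftrightarrow> u = v" if "u \<in> P h" "v \<in> P h" for u v
    using \<phi>_inj[OF h] that by (simp add: inj_on_eq_iff)
  have n1: "\<phi> h u \<noteq> f (\<phi> h v)" if "u \<in> P h" "v \<in> P h - D" for u v
    using orbit_source_0[OF h] that by blast
  have n2: "f (\<phi> h u) \<noteq> \<phi> h (h y)" if "u \<in> P h" "h y \<in> P h" "y \<notin> g ` D" for u y
    using orbit_target_0[OF h] that by metis
  \<comment> \<open>Two applications of \<open>f\<close> correspond to \<open>k = 1\<close> in
    \<open>orbit_source\<close>.\<close>
  have n3: "f (f (\<phi> h v)) \<noteq> \<phi> h (h y)" if "v \<in> P h - D" "h y \<in> P h" for v y
    using orbit_source[OF h, of "h y" v 1] that by auto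
  have t1: "\<tau> (\<phi> h u) \<longleftrightarrow> R u x" if "u \<in> P h" for u
    using that n1[of u] n2[of u] inj[of u] by (auto simp: \<tau>_def)
  have t2: "\<tau> (f (\<phi> h v)) \<longleftrightarrow> c v (inv h x)" if "v \<in> P h - D" for v
    using that n1[of _ v, symmetric] n3[of v] inj[of v] f_simps(3) by (auto simp: \<tau>_def)
  have t3: "\<tau> (inv f (\<phi> h (h y))) \<longleftrightarrow> c x y" if y: "h y \<in> P h" "y \<notin> g ` D" for y
  proof -
    have "\<phi> h (h y) = \<phi> h (h y') \<longleftrightarrow> y = y'" if "h y' \<in> P h" for y'
      using inj[OF y(1) that] by (simp add: K_simps h)
    moreover have "inv f (\<phi> h (h y)) \<noteq> \<phi> h u" if "u \<in> P h" for u
      using n2[OF that y] f_simps by metis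
    moreover have "inv f (\<phi> h (h y)) \<noteq> f (\<phi> h v)" if "v \<in> P h - D" for v
      using n3[OF that y(1)] f_simps by metis
    ultimately show ?thesis
      using y unfolding \<tau>_def by (auto simp: f_simps)
  qed
  have "finite M" using finite_P[OF h] by (simp add: M_def)
  then obtain p where p: "\<forall>w\<in>M. R w p \<longleftrightarrow> \<tau> w"
    "\<forall>w\<in>M. \<forall>k. (f ^^ k) w \<noteq> p \<and> (f ^^ k) p \<noteq> w" "R p (f p) \<longleftrightarrow> i"
    using star[of M \<tau>] by blast
  have "R (f p) (\<phi> h (h y)) \<longleftrightarrow> c x y" if y: "h y \<in> P h" "y \<notin> g ` D" for y
  proof -
    have "R (f p) (\<phi> h (h y)) \<longleftrightarrow> R (inv f (\<phi> h (h y))) p"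
      using f_simps rel_commute by metis
    then show ?thesis using t3[OF y] p(1) y by (simp add: M_def)
  qed
  then have "admissible x h p"
    using p t1 t2 unfolding admissible_def by (auto simp: M_def)
  then show ?thesis by blast
qed

lemma extend_domain:
  "\<exists>P' \<phi>'. stage R f i N K D g P' \<phi>' c \<and> extends K D g P \<phi> D g P' \<phi>' \<and> (\<forall>h\<in>K. x \<in> P' h)"
proof -
  \<comment> \<open>The choice depends on \<open>h\<close> only through the predicate
    \<open>admissible x h\<close>. Maps that agree on the enlarged control set have the same
    predicate and therefore receive the same image.\<close>
  define p where "p h = (SOME p. admissible x h p)" for h
  define P' where "P' h = insert x (P h)" for h
  define \<phi>' where "\<phi>' h = (if x \<in> P h then \<phi> h else (\<phi> h)(x := p h))" for h
  have p: "admissible x h (p h)" if "h \<in> K" for h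
    using someI_ex[OF admissible_exists[OF that]] by (simp add: p_def)
  have old: "\<phi>' h u = \<phi> h u" if "u \<in> P h" for h u
    using that by (auto simp: \<phi>'_def)
  have new: "\<phi>' h x = p h" if "x \<notin> P h" for h
    using that by (simp add: \<phi>'_def)
  have p_rel: "R (\<phi> h u) (p h) \<longleftrightarrow> R u x" if "h \<in> K" "u \<in> P h" for h u
    using p that unfolding admissible_def by blast
  have p_orb: "(f ^^ k) (\<phi> h u) \<noteq> p h" "(f ^^ k) (p h) \<noteq> \<phi> h u" if "h \<in> K" "u \<in> P h" for h u k
    using p that unfolding admissible_def by blast+
  have p_neq: "\<phi> h u \<noteq> p h" if "h \<in> K" "u \<in> P h" for h u
    using p_orb(1)[of h u 0] that by simp
  \<comment> \<open>A periodic \<open>p h\<close> would lie in \<open>N\<close>, whose points are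
    already values of \<open>\<phi> h\<close>.\<close>
  have p_self: "(f ^^ Suc k) (p h) \<noteq> p h" if h: "h \<in> K" for h k
  proof
    assume "(f ^^ Suc k) (p h) = p h"
    then have "p h \<in> N" by (rule periodic)
    then show False using p_neq[OF h, of "p h"] \<phi>_N[OF h] N_P[OF h] by auto
  qed
  \<comment> \<open>The new value lies on a fresh infinite orbit, so all orbit relations are old
    ones.\<close>
  have orb: "u \<in> P h \<and> v \<in> P h \<and> \<phi> h u = (f ^^ Suc k) (\<phi> h v)"
    if h: "h \<in> K" and uv: "u \<in> P' h" "v \<in> P' h" and eq: "\<phi>' h u = (f ^^ Suc k) (\<phi>' h v)" for h u v k
  proof (cases "x \<in> P h")
    case True
    then show ?thesis using uv eq old by (simp add: P'_def insert_absorb del: funpow.simps)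
  next
    case False
    then show ?thesis
      using uv eq old[of u h] old[of v h] new[OF False] p_orb[OF h] p_self[OF h]
      unfolding P'_def by (metis insertE)
  qed
  obtain F where F: "controls K P \<phi> F" using controlled by blast
  have ctrl: "controls K P' \<phi>' (F \<union> {x} \<union> preimages {x})"
    unfolding controls_def
  proof (intro conjI ballI impI)
    show "finite (F \<union> {x} \<union> preimages {x})"
      using F by (simp add: controls_def finite_preimages_set)
    show "P' h \<subseteq> F \<union> {x} \<union> preimages {x}" if "h \<in> K" for h
      using F that by (auto simp: controls_def P'_def)
    show "inv h ` P' h \<subseteq> F \<union> {x} \<union> preimages {x}" if "h \<in> K" for h
      using F that preimagesI[of h x "{x}"] by (auto simp: controls_def P'_def)
    fix h h' assume h: "h \<in> K" "h' \<in> K" and ag: "agree (F \<union> {x} \<union> preimages {x}) h h'"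
    have "agree F h h'" using ag agree_mono by blast
    then have same: "P h = P h'" "\<And>u. u \<in> P h \<Longrightarrow> \<phi> h u = \<phi> h' u"
      using F h unfolding controls_def by blast+
    then show "P' h = P' h'" by (simp add: P'_def)
    have inv_x: "inv h x = inv h' x" using ag by (simp add: agree_def)
    have "P h \<subseteq> F" using F h by (simp add: controls_def)
    then have inv_P: "inv h u = inv h' u" if "u \<in> P h" for u
      using ag that by (auto simp: agree_def)
    have hy: "h y \<in> P h \<longleftrightarrow> h' y \<in> P h" "h y \<in> P h \<Longrightarrow> h y = h' y" for y
      using inv_P h K_simps by metis+
    have "admissible x h = admissible x h'"
    proof
      fix p
      have "(\<forall>y. h y \<in> P h \<longrightarrow> y \<notin> g ` D \<longrightarrow> (R (f p) (\<phi> h (h y)) \<longleftrightarrow> c x y)) \<longleftrightarrow>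
        (\<forall>y. h' y \<in> P h' \<longrightarrow> y \<notin> g ` D \<longrightarrow> (R (f p) (\<phi> h' (h' y)) \<longleftrightarrow> c x y))"
        using hy same by metis
      moreover have "(\<forall>u\<in>P h. R (\<phi> h u) p \<longleftrightarrow> R u x) \<longleftrightarrow> (\<forall>u\<in>P h'. R (\<phi> h' u) p \<longleftrightarrow> R u x)"
        "(\<forall>u\<in>P h. \<forall>k. (f ^^ k) (\<phi> h u) \<noteq> p \<and> (f ^^ k) p \<noteq> \<phi> h u) \<longleftrightarrow>
         (\<forall>u\<in>P h'. \<forall>k. (f ^^ k) (\<phi> h' u) \<noteq> p \<and> (f ^^ k) p \<noteq> \<phi> h' u)"
        "(\<forall>v\<in>P h - D. R (f (\<phi> h v)) p \<longleftrightarrow> c v (inv h x)) \<longleftrightarrow>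
         (\<forall>v\<in>P h' - D. R (f (\<phi> h' v)) p \<longleftrightarrow> c v (inv h' x))"
        using same inv_x by auto
      ultimately show "admissible x h p = admissible x h' p"
        unfolding admissible_def by blast
    qed
    then have "p h = p h'" by (simp add: p_def)
    then show "\<phi>' h u = \<phi>' h' u" if "u \<in> P' h" for u
      using that same by (auto simp: \<phi>'_def P'_def)
  qed
  have "stage R f i N K D g P' \<phi>' c"
  proof unfold_locales
    show "finite D" "N \<subseteq> D" "inj_on g D" by (fact finite_D N_D g_inj)+
    show "g v = v" if "v \<in> N" for v using g_N that .
    show "R (g u) (g v) \<longleftrightarrow> R u v" if "u \<in> D" "v \<in> D" for u v using g_rel that .
    show "\<phi>' h v = v" if "h \<in> K" "v \<in> N" for h v
      using that \<phi>_N N_P old by (metis subsetD)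
    show "inj_on (\<phi>' h) (P' h)" if h: "h \<in> K" for h
    proof (cases "x \<in> P h")
      case True
      then show ?thesis using \<phi>_inj[OF h] by (simp add: P'_def \<phi>'_def insert_absorb)
    next
      case False
      then show ?thesis
        using \<phi>_inj[OF h] p_neq[OF h] p_neq[OF h, symmetric]
        by (auto simp: P'_def \<phi>'_def inj_on_def)
    qed
    show "R (\<phi>' h u) (\<phi>' h v) \<longleftrightarrow> R u v" if h: "h \<in> K" "u \<in> P' h" "v \<in> P' h" for h u v
    proof (cases "x \<in> P h")
      case True
      then show ?thesis using \<phi>_rel h by (simp add: P'_def \<phi>'_def insert_absorb)
    next
      case False
      then show ?thesis
        using h(2,3) \<phi>_rel[OF h(1)] p_rel[OF h(1)] old[of _ h] new[OF False] rel_commute not_refl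
        unfolding P'_def by (metis insertE)
    qed
    show "D \<subseteq> P' h" if "h \<in> K" for h using D_P that by (auto simp: P'_def)
    show "h (g v) \<in> P' h" if "h \<in> K" "v \<in> D" for h v using hg_P that by (auto simp: P'_def)
    show "\<phi>' h (h (g v)) = f (\<phi>' h v)" if "h \<in> K" "v \<in> D" for h v
      using equivariant that old hg_P D_P by (metis subsetD)
    show "v \<in> D" if "h \<in> K" "u \<in> P' h" "v \<in> P' h" "\<phi>' h u = (f ^^ Suc k) (\<phi>' h v)" for h u v k
      using orb[OF that] orbit_source that(1) by blast
    show "inv h u \<in> g ` D" if "h \<in> K" "u \<in> P' h" "v \<in> P' h" "\<phi>' h u = (f ^^ Suc k) (\<phi>' h v)"
      for h u v k
      using orb[OF that] orbit_target that(1) by blast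
    show "\<exists>F. controls K P' \<phi>' F" using ctrl by blast
    show "c (h y) y = i" if "h \<in> K" "h y \<notin> P' h" for h y
      using default that by (simp add: P'_def)
    show "R (f (\<phi>' h v)) (\<phi>' h (h y)) \<longleftrightarrow> c v y"
      if h: "h \<in> K" and v: "v \<in> P' h" "v \<notin> D" and y: "h y \<in> P' h" "y \<notin> g ` D" for h v y
    proof (cases "x \<in> P h")
      case True
      then show ?thesis
        using coherent[OF h _ v(2) _ y(2)] v(1) y(1) by (simp add: P'_def \<phi>'_def insert_absorb)
    next
      case x: False
      have a: "R (p h) (f (p h)) \<longleftrightarrow> i"
        "\<And>y. h y \<in> P h \<Longrightarrow> y \<notin> g ` D \<Longrightarrow> R (f (p h)) (\<phi> h (h y)) \<longleftrightarrow> c x y"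
        "\<And>v. v \<in> P h - D \<Longrightarrow> R (f (\<phi> h v)) (p h) \<longleftrightarrow> c v (inv h x)"
        using p[OF h] unfolding admissible_def by blast+
      show ?thesis
      proof (cases "h y = x")
        case True
        then have "y = inv h x" using K_simps h by metis
        show ?thesis
        proof (cases "v = x")
          case True
          \<comment> \<open>Here both vertices are mapped to \<open>p h\<close>; its adjacency to
            \<open>f (p h)\<close> is \<open>i\<close>, which is the value of \<open>c x y\<close>
            by \<open>default\<close>.\<close>
          then show ?thesis
            using \<open>h y = x\<close> a(1) rel_commute new[OF x] default[OF h, of y] x by simp
        next
          case False
          then have "v \<in> P h - D" using v by (simp add: P'_def)
          then show ?thesis
            using a(3)[of v] \<open>h y = x\<close> \<open>y = inv h x\<close> new[OF x] old[of v h] by simp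
        qed
      next
        case False
        then have hy: "h y \<in> P h" using y by (simp add: P'_def)
        show ?thesis
        proof (cases "v = x")
          case True
          then show ?thesis
            using a(2)[OF hy y(2)] new[OF x] old[OF hy] by simp
        next
          case False
          then have "v \<in> P h" using v by (simp add: P'_def)
          then show ?thesis
            using coherent[OF h _ v(2) hy y(2)] old[OF hy] old by simp
        qed
      qed
    qed
  qed
  moreover have "extends K D g P \<phi> D g P' \<phi>'"
    using old by (auto simp: extends_def P'_def)
  moreover have "\<forall>h\<in>K. x \<in> P' h"
    by (simp add: P'_def)
  ultimately show ?thesis by blast
qed

end

subsection \<open>Extending the stages\<close>

context stage
begin

text \<open>Once \<open>w\<close> is chosen as the value at \<open>v\<close>, the image of
  \<open>h w\<close> must be \<open>f (\<phi> h v)\<close>. Adjacencies of \<open>w\<close> to old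
  values of \<open>g\<close> are dictated by \<open>v\<close>, the others by \<open>c\<close>, whose
  independence of \<open>h\<close> lets one \<open>w\<close> serve the whole family.\<close>

lemma extend_forward:
  assumes v_D: "v \<notin> D" and v_P: "\<And>h. h \<in> K \<Longrightarrow> v \<in> P h"
  shows "\<exists>g' P' \<phi>' c'. stage R f i N K (insert v D) g' P' \<phi>' c' \<and>
    extends K D g P \<phi> (insert v D) g' P' \<phi>'"
proof -
  obtain F where F: "controls K P \<phi> F" using controlled by blast
  then have fin_F: "finite F" by (simp add: controls_def)
  have P_F: "P h \<subseteq> F" "inv h ` P h \<subseteq> F" if "h \<in> K" for h
    using F that by (simp_all add: controls_def)
  \<comment> \<open>Avoiding \<open>preimages F\<close> keeps \<open>h w\<close> out of
    \<open>F\<close>; avoiding \<open>preimages (images F)\<close> keeps it different from every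
    \<open>h' u\<close> with \<open>u\<close> in \<open>F\<close>.\<close>
  define X where "X = g ` D \<union> F \<union> preimages F \<union> preimages (images F)"
  have fin_X: "finite X"
    using fin_F finite_D by (simp add: X_def finite_preimages_set finite_images_set)
  obtain w where w: "w \<notin> X"
    "\<And>y. y \<in> X \<Longrightarrow> R y w \<longleftrightarrow> (if y \<in> g ` D then R (inv_into D g y) v else c v y)"
    "\<And>h h'. h \<in> K \<Longrightarrow> h' \<in> K \<Longrightarrow> h w = h' w \<Longrightarrow> agree F h h'"
    using splitting[OF fin_F fin_X, of "\<lambda>y. if y \<in> g ` D then R (inv_into D g y) v else c v y"] by blast
  have w_gD: "w \<notin> g ` D" using w(1) by (simp add: X_def)
  have w_g: "R (g u) w \<longleftrightarrow> R u v" if "u \<in> D" for u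
    using w(2)[of "g u"] that g_inj by (simp add: X_def)
  have w_c: "R y w \<longleftrightarrow> c v y" if "y \<in> F" "y \<notin> g ` D" for y
    using w(2)[of y] that by (simp add: X_def)
  have hw_F: "h w \<notin> F" if "h \<in> K" for h
  proof
    assume "h w \<in> F"
    then have "inv h (h w) \<in> preimages F" using preimagesI that by blast
    then show False using w(1) that by (simp add: X_def K_simps)
  qed
  have hw_neq: "h w \<noteq> h' u" if "h \<in> K" "h' \<in> K" "u \<in> F" for h h' u
  proof
    assume "h w = h' u"
    then have "inv h (h w) \<in> preimages (images F)"
      using preimagesI imagesI that by metis
    then show False using w(1) that by (simp add: X_def K_simps)
  qed
  have hw_P: "h w \<notin> P h'" if "h \<in> K" "h' \<in> K" for h h'
    using hw_F P_F that by blast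
  have preimage_F: "y \<in> F" if "h \<in> K" "h y \<in> P h" for h y
    using P_F(2)[OF that(1)] that K_simps(1)[OF that(1), of y] by (metis image_subset_iff)
  define g' where "g' = g(v := w)"
  define P' where "P' h = insert (h w) (P h)" for h
  define \<phi>' where "\<phi>' h = (\<phi> h)(h w := f (\<phi> h v))" for h
  \<comment> \<open>For a new domain point \<open>z = h w\<close> the value is read off from any
    such \<open>h\<close>. All of them agree on \<open>F\<close> by the choice of \<open>w\<close>,
    so the result is the same.\<close>
  define c' where "c' z y \<longleftrightarrow> (if \<exists>h\<in>K. h w = z \<and> h y \<in> P h
    then \<exists>h\<in>K. h w = z \<and> h y \<in> P h \<and> R (f (f (\<phi> h v))) (\<phi> h (h y)) else c z y)" for z y
  have g'_D: "g' u = g u" if "u \<in> D" for u using that v_D by (auto simp: g'_def)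
  have g'_v: "g' v = w" by (simp add: g'_def)
  have g'_image: "g' ` insert v D = insert w (g ` D)" using g'_D g'_v by auto
  have old: "\<phi>' h u = \<phi> h u" if "h \<in> K" "u \<in> P h" for h u
    using that hw_P by (auto simp: \<phi>'_def)
  have new: "\<phi>' h (h w) = f (\<phi> h v)" for h by (simp add: \<phi>'_def)
  have same: "P h = P h'" "u \<in> P h \<Longrightarrow> \<phi> h u = \<phi> h' u" "u \<in> P h \<Longrightarrow> inv h u = inv h' u"
    if h: "h \<in> K" "h' \<in> K" "agree F h h'" for h h' u
  proof -
    show "P h = P h'" "u \<in> P h \<Longrightarrow> \<phi> h u = \<phi> h' u"
      using F h unfolding controls_def by blast+
    show "u \<in> P h \<Longrightarrow> inv h u = inv h' u"
      using P_F(1)[OF h(1)] h(3) by (auto simp: agree_def)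
  qed
  have inj: "\<phi> h u = \<phi> h u' \<longleftrightarrow> u = u'" if "h \<in> K" "u \<in> P h" "u' \<in> P h" for h u u'
    using \<phi>_inj[OF that(1)] that by (simp add: inj_on_eq_iff)
  \<comment> \<open>As \<open>v\<close> is not in \<open>D\<close>, the forced value
    \<open>f (\<phi> h v)\<close> cannot have been taken already.\<close>
  have fresh: "(f ^^ Suc k) (\<phi> h v) \<noteq> \<phi> h u" if "h \<in> K" "u \<in> P h" for h u k
    using orbit_source[OF that(1) that(2) v_P[OF that(1)], of k] v_D by metis
  have fresh_0: "f (\<phi> h v) \<noteq> \<phi> h u" if "h \<in> K" "u \<in> P h" for h u
    using fresh[of h u 0] that by simp
  have aperiodic: "(f ^^ Suc k) (\<phi> h v) \<noteq> \<phi> h v" if "h \<in> K" for h k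
    using fresh v_P that by blast
  have ctrl: "controls K P' \<phi>' (F \<union> {w} \<union> images {w})"
    unfolding controls_def
  proof (intro conjI ballI impI)
    show "finite (F \<union> {w} \<union> images {w})"
      using fin_F by (simp add: finite_images_set)
    show "P' h \<subseteq> F \<union> {w} \<union> images {w}" if "h \<in> K" for h
      using P_F that imagesI[of h w "{w}"] by (auto simp: P'_def)
    show "inv h ` P' h \<subseteq> F \<union> {w} \<union> images {w}" if "h \<in> K" for h
      using P_F(2)[OF that] that by (auto simp: P'_def K_simps)
    fix h h' assume h: "h \<in> K" "h' \<in> K" and ag: "agree (F \<union> {w} \<union> images {w}) h h'"
    have "agree F h h'" using ag agree_mono by blast
    note s = same[OF h this]
    have "h w = h' w" using ag by (simp add: agree_def)
    then show "P' h = P' h'" using s(1) by (simp add: P'_def)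
    show "\<phi>' h u = \<phi>' h' u" if "u \<in> P' h" for u
      using that s(2)[of u] s(2)[OF v_P[OF h(1)]] \<open>h w = h' w\<close> by (auto simp: P'_def \<phi>'_def)
  qed
  have w_rel: "R (h w) u \<longleftrightarrow> R (f (\<phi> h v)) (\<phi> h u)" if h: "h \<in> K" and u: "u \<in> P h" for h u
  proof -
    have "R (h w) u \<longleftrightarrow> R (inv h u) w"
      using Aut_rel_left[OF K_Aut[OF h]] rel_commute by metis
    also have "\<dots> \<longleftrightarrow> R (f (\<phi> h v)) (\<phi> h u)"
    proof (cases "inv h u \<in> g ` D")
      case True
      then obtain t where t: "t \<in> D" "inv h u = g t" by blast
      then have "u = h (g t)" using K_simps(2)[OF h] by metis
      have "R (inv h u) w \<longleftrightarrow> R t v" using t w_g by simp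
      also have "\<dots> \<longleftrightarrow> R (\<phi> h t) (\<phi> h v)"
        using \<phi>_rel[OF h _ v_P[OF h]] D_P[OF h] t(1) by blast
      also have "\<dots> \<longleftrightarrow> R (\<phi> h u) (f (\<phi> h v))"
        using equivariant[OF h t(1)] \<open>u = h (g t)\<close> f_simps by simp
      finally show ?thesis using rel_commute by blast
    next
      case False
      have "inv h u \<in> F" using P_F(2)[OF h] u by blast
      then have "R (inv h u) w \<longleftrightarrow> c v (inv h u)" using w_c False by blast
      also have "\<dots> \<longleftrightarrow> R (f (\<phi> h v)) (\<phi> h u)"
        using coherent[OF h v_P[OF h] v_D, of "inv h u"] False u by (simp add: K_simps h)
      finally show ?thesis .
    qed
    finally show ?thesis .
  qed
  have orb: "v' \<in> insert v D \<and> inv h u \<in> g' ` insert v D"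
    if h: "h \<in> K" and u: "u \<in> P' h" and v': "v' \<in> P' h"
      and eq: "\<phi>' h u = (f ^^ Suc k) (\<phi>' h v')" for h u v' k
  proof (cases "v' = h w")
    case True
    then have "\<phi>' h u = (f ^^ Suc (Suc k)) (\<phi> h v)"
      using eq new by (simp add: funpow_swap1)
    moreover have "u \<noteq> h w"
    proof
      assume "u = h w"
      then have "f (\<phi> h v) = f ((f ^^ Suc k) (\<phi> h v))"
        using calculation new by simp
      then show False using aperiodic[OF h, of k] f_simps(3) by metis
    qed
    ultimately show ?thesis using fresh[OF h, of u "Suc k"] u old[OF h] by (simp add: P'_def)
  next
    case False
    then have v'_P: "v' \<in> P h" using v' by (simp add: P'_def)
    show ?thesis
    proof (cases "u = h w")
      case True
      then have e: "\<phi> h v = (f ^^ k) (\<phi> h v')"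
        using eq new old[OF h v'_P] f_simps(3) by simp
      have "v' \<in> insert v D"
      \<comment> \<open>Exponent zero gives \<open>v' = v\<close>, the vertex just added to the
        domain; a positive exponent is an old orbit relation.\<close>
      proof (cases k)
        case 0
        then show ?thesis using e inj[OF h v_P[OF h] v'_P] by simp
      next
        case (Suc m)
        then show ?thesis using orbit_source[OF h v_P[OF h] v'_P] e by blast
      qed
      then show ?thesis using True g'_image h by (simp add: K_simps)
    next
      case False
      then have u_P: "u \<in> P h" using u by (simp add: P'_def)
      have e: "\<phi> h u = (f ^^ Suc k) (\<phi> h v')"
        using eq old[OF h u_P] old[OF h v'_P] by simp
      show ?thesis
        using orbit_source[OF h u_P v'_P e] orbit_target[OF h u_P v'_P e] g'_image by blast
    qed
  qed
  have "stage R f i N K (insert v D) g' P' \<phi>' c'"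
  proof unfold_locales
    show "finite (insert v D)" "N \<subseteq> insert v D" using finite_D N_D by auto
    show "g' u = u" if "u \<in> N" for u using g_N N_D that g'_D by auto
    show "inj_on g' (insert v D)"
    proof -
      have "inj_on g' D" using g_inj g'_D by (simp cong: inj_on_cong)
      moreover have "g' ` D = g ` D" using g'_D by simp
      ultimately show ?thesis using w_gD v_D g'_v by simp
    qed
    show "R (g' a) (g' b) \<longleftrightarrow> R a b" if "a \<in> insert v D" "b \<in> insert v D" for a b
    proof (cases "a = v"; cases "b = v")
      assume "a = v" "b = v"
      then show ?thesis using not_refl by simp
    next
      assume "a = v" "b \<noteq> v"
      then show ?thesis
        using that w_g[of b] g'_D[of b] g'_v rel_commute[of w "g b"] rel_commute[of v b] by simp
    next
      assume "a \<noteq> v" "b = v"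
      then show ?thesis using that w_g[of a] g'_D[of a] g'_v by simp
    next
      assume "a \<noteq> v" "b \<noteq> v"
      then show ?thesis using that g_rel[of a b] g'_D[of a] g'_D[of b] by simp
    qed
    show "\<phi>' h u = u" if "h \<in> K" "u \<in> N" for h u
      using that \<phi>_N N_P old by (metis subsetD)
    show "inj_on (\<phi>' h) (P' h)" if h: "h \<in> K" for h
    proof -
      have "inj_on (\<phi>' h) (P h)" using \<phi>_inj[OF h] old[OF h] by (simp cong: inj_on_cong)
      moreover have "\<phi>' h ` P h = \<phi> h ` P h" using old[OF h] by simp
      moreover have "f (\<phi> h v) \<notin> \<phi> h ` P h" using fresh_0[OF h] by auto
      ultimately show ?thesis using new[of h] hw_P[OF h h] by (simp add: P'_def)
    qed
    show "R (\<phi>' h a) (\<phi>' h b) \<longleftrightarrow> R a b" if h: "h \<in> K" "a \<in> P' h" "b \<in> P' h" for h a b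
    proof (cases "a = h w"; cases "b = h w")
      assume "a = h w" "b = h w"
      then show ?thesis using not_refl by simp
    next
      assume "a = h w" "b \<noteq> h w"
      then show ?thesis
        using h w_rel[OF h(1), of b] old[OF h(1), of b] new[of h] by (simp add: P'_def)
    next
      assume "a \<noteq> h w" "b = h w"
      then show ?thesis
        using h w_rel[OF h(1), of a] old[OF h(1), of a] new[of h]
          rel_commute[of a "h w"] rel_commute[of "\<phi> h a" "f (\<phi> h v)"]
        by (simp add: P'_def)
    next
      assume "a \<noteq> h w" "b \<noteq> h w"
      then show ?thesis
        using h \<phi>_rel[OF h(1), of a b] old[OF h(1), of a] old[OF h(1), of b] by (simp add: P'_def)
    qed
    show "insert v D \<subseteq> P' h" if "h \<in> K" for h using D_P v_P that by (auto simp: P'_def)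
    show "h (g' u) \<in> P' h" if "h \<in> K" "u \<in> insert v D" for h u
      using hg_P that g'_D g'_v by (auto simp: P'_def)
    show "\<phi>' h (h (g' u)) = f (\<phi>' h u)" if h: "h \<in> K" "u \<in> insert v D" for h u
    proof (cases "u = v")
      case True
      then show ?thesis using new g'_v old[OF h(1) v_P[OF h(1)]] by simp
    next
      case False
      then have "u \<in> D" using h by simp
      then show ?thesis
        using equivariant hg_P D_P old g'_D h(1) by (metis subsetD)
    qed
    show "v' \<in> insert v D"
      if "h \<in> K" "u \<in> P' h" "v' \<in> P' h" "\<phi>' h u = (f ^^ Suc k) (\<phi>' h v')" for h u v' k
      using orb[OF that] by blast
    show "inv h u \<in> g' ` insert v D"
      if "h \<in> K" "u \<in> P' h" "v' \<in> P' h" "\<phi>' h u = (f ^^ Suc k) (\<phi>' h v')" for h u v' k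
      using orb[OF that] by blast
    show "\<exists>F. controls K P' \<phi>' F" using ctrl by blast
    show "R (f (\<phi>' h z)) (\<phi>' h (h y)) \<longleftrightarrow> c' z y"
      if h: "h \<in> K" and z: "z \<in> P' h" "z \<notin> insert v D" and y: "h y \<in> P' h" "y \<notin> g' ` insert v D"
      for h z y
    proof -
      have "y \<noteq> w" "y \<notin> g ` D" using y(2) g'_image by auto
      then have hy: "h y \<in> P h" using y(1) h by (simp add: P'_def K_simps)
      show ?thesis
      proof (cases "z = h w")
        case True
        have indep: "R (f (f (\<phi> h' v))) (\<phi> h' (h' y)) \<longleftrightarrow> R (f (f (\<phi> h v))) (\<phi> h (h y))"
          if h': "h' \<in> K" "h' w = z" for h'
        proof -
          have "agree F h h'" using w(3) h h' True by simp
          note s = same[OF h h'(1) this]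
          have "inv h' (h y) = y" using s(3)[OF hy] h by (simp add: K_simps)
          then have "h' y = h y" using K_simps(2)[OF h'(1)] by metis
          then show ?thesis using s(2)[OF hy] s(2)[OF v_P[OF h]] by simp
        qed
        have ex: "\<exists>h\<in>K. h w = z \<and> h y \<in> P h"
          using h hy True by blast
        have "c' z y \<longleftrightarrow> (\<exists>h\<in>K. h w = z \<and> h y \<in> P h \<and> R (f (f (\<phi> h v))) (\<phi> h (h y)))"
          unfolding c'_def using ex by (rule if_P)
        also have "\<dots> \<longleftrightarrow> R (f (f (\<phi> h v))) (\<phi> h (h y))"
          using indep h hy True by blast
        finally have "c' z y \<longleftrightarrow> R (f (f (\<phi> h v))) (\<phi> h (h y))" .
        then show ?thesis using True new old[OF h hy] by simp
      next
        case False
        then have z_P: "z \<in> P h" using z by (simp add: P'_def)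
        then have "h' w \<noteq> z" if "h' \<in> K" for h' using hw_P[OF that h] by blast
        then have "c' z y = c z y" unfolding c'_def by auto
        then show ?thesis
          using coherent[OF h z_P _ hy \<open>y \<notin> g ` D\<close>] z(2) old[OF h] hy z_P by simp
      qed
    qed
    show "c' (h y) y = i" if h: "h \<in> K" "h y \<notin> P' h" for h y
    proof -
      \<comment> \<open>Such an \<open>h'\<close> would put \<open>y\<close> into \<open>F\<close>,
        from whose images \<open>h w\<close> was kept away. So \<open>c'\<close> does not override
        the default value.\<close>
      have "h' w \<noteq> h y" if "h' \<in> K" "h' y \<in> P h'" for h'
        using hw_neq[OF that(1) h(1) preimage_F[OF that]] .
      then have "c' (h y) y = c (h y) y" unfolding c'_def by auto
      then show ?thesis using default h by (simp add: P'_def)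
    qed
  qed
  moreover have "extends K D g P \<phi> (insert v D) g' P' \<phi>'"
    using old g'_D by (auto simp: extends_def P'_def)
  ultimately show ?thesis by blast
qed

end

section \<open>Enlarging the ranges of the partial conjugating maps\<close>

lemma (in setting) splitting_inv:
  assumes "finite F" "finite X"
  obtains w where "w \<notin> X" "\<And>y. y \<in> X \<Longrightarrow> R y w \<longleftrightarrow> \<tau> y"
    "\<And>h h'. h \<in> K \<Longrightarrow> h' \<in> K \<Longrightarrow> inv h w = inv h' w \<Longrightarrow> agree F h h'"
proof -
  interpret dual: setting R "inv f" i N "inv ` K" by (rule dual_setting)
  obtain w where w: "w \<notin> X" "\<And>y. y \<in> X \<Longrightarrow> R y w \<longleftrightarrow> \<tau> y"
    "\<And>h h'. h \<in> inv ` K \<Longrightarrow> h' \<in> inv ` K \<Longrightarrow> h w = h' w \<Longrightarrow> agree F h h'"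
    using dual.splitting[OF assms, of \<tau>] by blast
  have "agree F h h'" if "h \<in> K" "h' \<in> K" "inv h w = inv h' w" for h h'
    using w(3)[of "inv h" "inv h'"] that by (auto simp: agree_def inv_inv_eq K_bij)
  then show thesis using w that by blast
qed

context stage
begin

text \<open>One vertex \<open>x\<close> can be sent to \<open>q\<close> by all \<open>h\<close> in
  \<open>G\<close>, because \<open>P\<close> and \<open>\<phi>\<close> are constant on
  \<open>G\<close>. Here \<open>q\<close> is given, so nothing is known about its adjacency to
  \<open>f q\<close>; instead of obeying \<open>c\<close>, the step rewrites \<open>c\<close> at the
  pairs involving \<open>x\<close>.\<close>

lemma extend_range_class:
  assumes h1: "h1 \<in> K" and fin: "finite F0" and P_F0: "P h1 \<subseteq> F0"
    and G: "G = {h \<in> K. agree F0 h1 h}"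
    and P_G: "\<And>h. h \<in> G \<Longrightarrow> P h = P h1"
    and \<phi>_G: "\<And>h u. h \<in> G \<Longrightarrow> u \<in> P h1 \<Longrightarrow> \<phi> h u = \<phi> h1 u"
    and q_orbit: "\<And>u k. u \<in> P h1 \<Longrightarrow> (f ^^ k) (\<phi> h1 u) \<noteq> q \<and> (f ^^ k) q \<noteq> \<phi> h1 u"
  shows "\<exists>P' \<phi>' c'. stage R f i N K D g P' \<phi>' c' \<and> extends K D g P \<phi> D g P' \<phi>' \<and>
    (\<forall>h\<in>G. q \<in> \<phi>' h ` P' h) \<and> (\<forall>h\<in>K - G. P' h = P h \<and> \<phi>' h = \<phi> h)"
proof -
  obtain F where F: "controls K P \<phi> F" using controlled by blast
  then have fin_F: "finite F" by (simp add: controls_def)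
  have P_F: "P h \<subseteq> F" "inv h ` P h \<subseteq> F" if "h \<in> K" for h
    using F that by (simp_all add: controls_def)
  \<comment> \<open>Avoiding these images ensures \<open>h y \<noteq> x\<close> for \<open>y\<close>
    in \<open>F\<close>, and that no \<open>inv h x\<close> is an \<open>inv h' u\<close> with
    \<open>u\<close> in \<open>F\<close>. Both protect \<open>default\<close> when \<open>c\<close>
    is rewritten.\<close>
  define X where "X = F \<union> images F \<union> images (preimages F)"
  have fin_X: "finite X"
    using fin_F by (simp add: X_def finite_preimages_set finite_images_set)
  define \<tau> where "\<tau> u = R (\<phi> h1 u) q" for u
  \<comment> \<open>Separation of the inverses at \<open>x\<close> by \<open>F0\<close> prevents
    maps outside \<open>G\<close> from sharing the preimage of \<open>x\<close> with a map in
    \<open>G\<close>.\<close>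
  obtain x where x: "x \<notin> X" "\<And>u. u \<in> X \<Longrightarrow> R u x \<longleftrightarrow> \<tau> u"
    "\<And>h h'. h \<in> K \<Longrightarrow> h' \<in> K \<Longrightarrow> inv h x = inv h' x \<Longrightarrow> agree F0 h h'"
    using splitting_inv[OF fin fin_X, of \<tau>] by blast
  have x_F: "x \<notin> F" using x(1) by (simp add: X_def)
  have hy_F: "h y \<noteq> x" if "h \<in> K" "y \<in> F" for h y
    using x(1) imagesI[OF that] by (auto simp: X_def)
  have hh_F: "y \<noteq> inv h x" if "h \<in> K" "h' \<in> K" "h' y \<in> F" for h h' y
  proof
    assume "y = inv h x"
    then have "h (inv h' (h' y)) = x" using that by (simp add: K_simps)
    moreover have "h (inv h' (h' y)) \<in> images (preimages F)"
      using that imagesI preimagesI by metis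
    ultimately show False using x(1) by (simp add: X_def)
  qed
  have x_P: "x \<notin> P h" if "h \<in> K" for h using x_F P_F that by blast
  have x_rel: "R u x \<longleftrightarrow> R (\<phi> h1 u) q" if "u \<in> P h1" for u
    using x(2)[of u] P_F(1)[OF h1] that by (auto simp: X_def \<tau>_def)
  have G_K: "h \<in> K" if "h \<in> G" for h using that G by blast
  have inv_G: "inv h u = inv h1 u" if "h \<in> G" "u \<in> P h1" for h u
    using that G P_F0 by (auto simp: agree_def)
  have hy_G: "h y = h1 y" if "h \<in> G" "h y \<in> P h1" for h y
  proof -
    have "inv h1 (h y) = y" using inv_G[OF that] by (simp add: K_simps G_K that(1))
    then show ?thesis using K_simps(2)[OF h1] by metis
  qed
  have preimage_F: "y \<in> F" if "h \<in> K" "h y \<in> P h" for h y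
    using P_F(2)[OF that(1)] that K_simps(1)[OF that(1), of y] by (metis image_subset_iff)
  define P' where "P' h = (if h \<in> G then insert x (P h) else P h)" for h
  define \<phi>' where "\<phi>' h = (if h \<in> G then (\<phi> h)(x := q) else \<phi> h)" for h
  \<comment> \<open>The cases are the new constraints for \<open>G\<close>: \<open>x\<close> in both
    roles of \<open>coherent\<close>, \<open>x\<close> as the vertex outside \<open>D\<close>, and
    \<open>x\<close> as the vertex \<open>h y\<close>. The values for \<open>h1\<close> represent
    the class.\<close>
  define c' where "c' z y = (if z = x then
      if \<exists>h\<in>G. h y = x then R (f q) q
      else if h1 y \<in> P h1 then R (f q) (\<phi> h1 (h1 y)) else c x y
    else if (\<exists>h\<in>G. h y = x) \<and> z \<in> P h1 then R (f (\<phi> h1 z)) q else c z y)" for z y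
  have old: "\<phi>' h u = \<phi> h u" if "h \<in> K" "u \<in> P h" for h u
    using that x_P by (auto simp: \<phi>'_def)
  have new: "\<phi>' h x = q" if "h \<in> G" for h using that by (simp add: \<phi>'_def)
  have outside: "P' h = P h" "\<phi>' h = \<phi> h" if "h \<notin> G" for h
    using that by (simp_all add: P'_def \<phi>'_def)
  have q_orb: "(f ^^ k) (\<phi> h u) \<noteq> q" "(f ^^ k) q \<noteq> \<phi> h u" if "h \<in> G" "u \<in> P h" for h u k
    using q_orbit[of u k] that P_G \<phi>_G by auto
  have q_neq: "\<phi> h u \<noteq> q" if "h \<in> G" "u \<in> P h" for h u
    using q_orb(1)[of h u 0] that by simp
  have q_self: "(f ^^ Suc k) q \<noteq> q" for k
  proof
    assume "(f ^^ Suc k) q = q"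
    then have "q \<in> N" by (rule periodic)
    then show False using q_orbit[of q 0] \<phi>_N[OF h1] N_P[OF h1] by auto
  qed
  have orb: "u \<in> P h \<and> v \<in> P h \<and> \<phi> h u = (f ^^ Suc k) (\<phi> h v)"
    if h: "h \<in> K" and uv: "u \<in> P' h" "v \<in> P' h" and eq: "\<phi>' h u = (f ^^ Suc k) (\<phi>' h v)" for h u v k
  proof (cases "h \<in> G")
    case True
    have "u \<noteq> x"
    proof
      assume "u = x"
      then have "(f ^^ Suc k) (\<phi>' h v) = q" using eq new[OF True] by simp
      moreover have "v = x \<or> v \<in> P h" using uv True by (auto simp: P'_def)
      ultimately show False
        using q_orb(1)[OF True, of v "Suc k"] q_self[of k] new[OF True] old[OF h, of v] by metis
    qed
    then have u: "u \<in> P h" using uv by (simp add: P'_def True)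
    have "v \<noteq> x"
    proof
      assume "v = x"
      then have "(f ^^ Suc k) q = \<phi> h u" using eq new[OF True] old[OF h u] by simp
      then show False using q_orb(2)[OF True u] by metis
    qed
    then have v: "v \<in> P h" using uv by (simp add: P'_def True)
    show ?thesis using u v eq old[OF h] by simp
  next
    case False
    then show ?thesis using uv eq outside by simp
  qed
  have ctrl: "controls K P' \<phi>' (F \<union> F0 \<union> {x} \<union> preimages {x})"
    unfolding controls_def
  proof (intro conjI ballI impI)
    show "finite (F \<union> F0 \<union> {x} \<union> preimages {x})"
      using fin_F fin by (simp add: finite_preimages_set)
    show "P' h \<subseteq> F \<union> F0 \<union> {x} \<union> preimages {x}" if "h \<in> K" for h
      using P_F(1)[OF that] by (auto simp: P'_def)
    show "inv h ` P' h \<subseteq> F \<union> F0 \<union> {x} \<union> preimages {x}" if "h \<in> K" for h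
      using P_F(2)[OF that] preimagesI[OF that, of x "{x}"] by (auto simp: P'_def)
    fix h h' assume h: "h \<in> K" "h' \<in> K" and ag: "agree (F \<union> F0 \<union> {x} \<union> preimages {x}) h h'"
    have "agree F h h'" using ag by (rule agree_mono) blast
    then have same: "P h = P h'" "\<And>u. u \<in> P h \<Longrightarrow> \<phi> h u = \<phi> h' u"
      using F h unfolding controls_def by blast+
    have "agree F0 h h'" using ag by (rule agree_mono) blast
    then have GG: "h \<in> G \<longleftrightarrow> h' \<in> G"
      using h G agree_trans agree_sym by blast
    then show "P' h = P' h'" using same by (simp add: P'_def)
    show "\<phi>' h u = \<phi>' h' u" if "u \<in> P' h" for u
      using that same GG by (auto simp: \<phi>'_def P'_def split: if_splits)
  qed
  have "stage R f i N K D g P' \<phi>' c'"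
  proof unfold_locales
    show "finite D" "N \<subseteq> D" "inj_on g D" by (fact finite_D N_D g_inj)+
    show "g v = v" if "v \<in> N" for v using g_N that .
    show "R (g u) (g v) \<longleftrightarrow> R u v" if "u \<in> D" "v \<in> D" for u v using g_rel that .
    show "\<phi>' h v = v" if "h \<in> K" "v \<in> N" for h v
      using that \<phi>_N N_P old by (metis subsetD)
    show "inj_on (\<phi>' h) (P' h)" if h: "h \<in> K" for h
    proof (cases "h \<in> G")
      case True
      have "inj_on (\<phi>' h) (P h)" using \<phi>_inj[OF h] old[OF h] by (simp cong: inj_on_cong)
      moreover have "\<phi>' h ` P h = \<phi> h ` P h" using old[OF h] by simp
      moreover have "q \<notin> \<phi> h ` P h" using q_neq[OF True] by auto
      ultimately show ?thesis using new[OF True] x_P[OF h] True by (simp add: P'_def)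
    next
      case False
      then show ?thesis using \<phi>_inj[OF h] outside by simp
    qed
    show "R (\<phi>' h a) (\<phi>' h b) \<longleftrightarrow> R a b" if h: "h \<in> K" "a \<in> P' h" "b \<in> P' h" for h a b
    proof (cases "h \<in> G")
      case True
      note xr = x_rel[folded P_G[OF True]]
      show ?thesis
      proof (cases "a = x"; cases "b = x")
        assume "a = x" "b = x"
        then show ?thesis using not_refl by simp
      next
        assume "a = x" "b \<noteq> x"
        then show ?thesis
          using h xr[of b] old[OF h(1), of b] new[OF True] \<phi>_G[OF True, of b] P_G[OF True] True
            rel_commute[of x b] rel_commute[of q "\<phi> h b"]
          by (simp add: P'_def)
      next
        assume "a \<noteq> x" "b = x"
        then show ?thesis
          using h xr[of a] old[OF h(1), of a] new[OF True] \<phi>_G[OF True, of a] P_G[OF True] True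
          by (simp add: P'_def)
      next
        assume "a \<noteq> x" "b \<noteq> x"
        then show ?thesis
          using h \<phi>_rel[OF h(1), of a b] old[OF h(1), of a] old[OF h(1), of b] True
          by (simp add: P'_def)
      qed
    next
      case False
      then show ?thesis using \<phi>_rel h outside by simp
    qed
    show "D \<subseteq> P' h" if "h \<in> K" for h using D_P that by (auto simp: P'_def)
    show "h (g v) \<in> P' h" if "h \<in> K" "v \<in> D" for h v using hg_P that by (auto simp: P'_def)
    show "\<phi>' h (h (g v)) = f (\<phi>' h v)" if "h \<in> K" "v \<in> D" for h v
      using equivariant that old hg_P D_P by (metis subsetD)
    show "v \<in> D" if "h \<in> K" "u \<in> P' h" "v \<in> P' h" "\<phi>' h u = (f ^^ Suc k) (\<phi>' h v)" for h u v k
      using orb[OF that] orbit_source that(1) by blast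
    show "inv h u \<in> g ` D" if "h \<in> K" "u \<in> P' h" "v \<in> P' h" "\<phi>' h u = (f ^^ Suc k) (\<phi>' h v)"
      for h u v k
      using orb[OF that] orbit_target that(1) by blast
    show "\<exists>F. controls K P' \<phi>' F" using ctrl by blast
    show "c' (h y) y = i" if h: "h \<in> K" "h y \<notin> P' h" for h y
    proof -
      have d: "c (h y) y = i" using default h by (auto simp: P'_def split: if_splits)
      show ?thesis
      proof (cases "h y = x")
        case True
        \<comment> \<open>Here \<open>h\<close> is outside \<open>G\<close>, since \<open>x\<close>
          is not in \<open>P' h\<close>; a common preimage of \<open>x\<close> under
          \<open>h\<close> and a member of \<open>G\<close> would force \<open>h\<close> into
          \<open>G\<close>.\<close>
        have "h' y \<noteq> x" if h': "h' \<in> G" for h'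
        proof
          assume "h' y = x"
          then have "inv h' x = inv h x" using True K_simps(1) h(1) G_K[OF h'] by metis
          then have "agree F0 h' h" using x(3)[OF G_K[OF h'] h(1)] by blast
          then have "h \<in> G" using h' h(1) G agree_trans by blast
          then show False using True h(2) by (simp add: P'_def)
        qed
        moreover have "h1 y \<notin> P h1" using preimage_F[OF h1] hy_F[OF h(1)] True by blast
        ultimately show ?thesis using d True by (simp add: c'_def)
      next
        case False
        have "\<not> ((\<exists>h\<in>G. h y = x) \<and> h y \<in> P h1)"
        proof
          assume "(\<exists>h\<in>G. h y = x) \<and> h y \<in> P h1"
          then obtain h' where h': "h' \<in> G" "h' y = x" "h y \<in> P h1" by blast
          then have "y = inv h' x" using K_simps(1)[OF G_K[OF h'(1)]] by metis
          then show False using hh_F[OF G_K[OF h'(1)] h(1)] h'(3) P_F(1)[OF h1] by blast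
        qed
        then have "c' (h y) y = c (h y) y"
          using False unfolding c'_def by (simp only: if_False)
        then show ?thesis using d by simp
      qed
    qed
    show "R (f (\<phi>' h v)) (\<phi>' h (h y)) \<longleftrightarrow> c' v y"
      if h: "h \<in> K" and v: "v \<in> P' h" "v \<notin> D" and y: "h y \<in> P' h" "y \<notin> g ` D" for h v y
    proof (cases "h \<in> G")
      case False
      then have vy: "v \<in> P h" "h y \<in> P h" using v y outside by simp_all
      have "v \<noteq> x" using vy x_P h by blast
      moreover have "\<not> (\<exists>h\<in>G. h y = x)" using preimage_F[OF h vy(2)] hy_F G_K by blast
      ultimately have "c' v y = c v y" unfolding c'_def by simp
      then show ?thesis using coherent[OF h vy(1) v(2) vy(2) y(2)] outside[OF False] by simp
    next
      case True
      show ?thesis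
      proof (cases "h y = x")
        case hy: True
        then have ex: "\<exists>h\<in>G. h y = x" using True by blast
        show ?thesis
        proof (cases "v = x")
          case True
          then show ?thesis using ex hy new[OF \<open>h \<in> G\<close>] by (simp add: c'_def)
        next
          case False
          then have "v \<in> P h" using v True by (simp add: P'_def)
          then show ?thesis
            using ex hy False new[OF True] old[OF h] \<phi>_G[OF True] P_G[OF True] by (simp add: c'_def)
        qed
      next
        case False
        then have hy: "h y \<in> P h" using y True by (simp add: P'_def)
        then have nex: "\<not> (\<exists>h\<in>G. h y = x)" using preimage_F[OF h] hy_F G_K by blast
        have h1y: "h y = h1 y" using hy_G[OF True] hy P_G[OF True] by simp
        show ?thesis
        proof (cases "v = x")
          case True
          then show ?thesis
            using nex hy h1y new[OF \<open>h \<in> G\<close>] old[OF h hy] P_G[OF \<open>h \<in> G\<close>] \<phi>_G[OF \<open>h \<in> G\<close>]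
            by (simp add: c'_def)
        next
          case False
          then have vP: "v \<in> P h" using v True by (simp add: P'_def)
          have "c' v y = c v y" using nex False unfolding c'_def by simp
          then show ?thesis
            using coherent[OF h vP v(2) hy y(2)] old[OF h hy] old[OF h vP] by simp
        qed
      qed
    qed
  qed
  moreover have "extends K D g P \<phi> D g P' \<phi>'"
    using old by (auto simp: extends_def P'_def)
  moreover have "\<forall>h\<in>G. q \<in> \<phi>' h ` P' h"
    using new by (force simp: P'_def)
  moreover have "\<forall>h\<in>K - G. P' h = P h \<and> \<phi>' h = \<phi> h"
    using outside by simp
  ultimately show ?thesis by blast
qed

text \<open>Only the orbit of \<open>q\<close> has to be met: in the limit the equation spreads the
  range along whole orbits, whereas adding a point to an orbit already met could break the orbit
  invariants. Values of \<open>h\<close> and \<open>inv h\<close> on \<open>F\<close> range over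
  finite sets, so finitely many classes must be treated.\<close>

lemma extend_range:
  "\<exists>P' \<phi>' c'. stage R f i N K D g P' \<phi>' c' \<and> extends K D g P \<phi> D g P' \<phi>' \<and>
    (\<forall>h\<in>K. \<exists>u\<in>P' h. \<exists>k. (f ^^ k) (\<phi>' h u) = q \<or> (f ^^ k) q = \<phi>' h u)"
proof -
  obtain F where F: "controls K P \<phi> F" using controlled by blast
  then have fin_F: "finite F" by (simp add: controls_def)
  \<comment> \<open>A code for the agreement class of \<open>h\<close>; the restriction makes
    equality of codes equivalent to agreement on \<open>F\<close>.\<close>
  define r where "r h = restrict (\<lambda>u. (h u, inv h u)) F" for h :: "'v \<Rightarrow> 'v"
  have r_agree: "r h = r h' \<longleftrightarrow> agree F h h'" for h h'
    unfolding r_def agree_def by (auto simp: restrict_def fun_eq_iff)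
  have "r ` K \<subseteq> F \<rightarrow>\<^sub>E images F \<times> preimages F"
    by (auto simp: r_def imagesI preimagesI)
  then have fin_r: "finite (r ` K)"
    using fin_F by (meson finite_PiE finite_SigmaI finite_images_set finite_preimages_set finite_subset)
  define reached where "reached P' \<phi>' h \<longleftrightarrow>
    (\<exists>u\<in>P' h. \<exists>k. (f ^^ k) (\<phi>' h u) = q \<or> (f ^^ k) q = \<phi>' h u)"
    for P' :: "('v \<Rightarrow> 'v) \<Rightarrow> 'v set" and \<phi>' :: "('v \<Rightarrow> 'v) \<Rightarrow> 'v \<Rightarrow> 'v" and h
  \<comment> \<open>The vertex added for one class is not controlled by \<open>F\<close>; so the classes are fixed in advance,
    and the later ones keep their \<open>\<phi>\<close> until they are treated.\<close>
  have "\<exists>P' \<phi>' c'. stage R f i N K D g P' \<phi>' c' \<and> extends K D g P \<phi> D g P' \<phi>' \<and>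
    (\<forall>h\<in>K. r h \<in> S \<longrightarrow> reached P' \<phi>' h) \<and> (\<forall>h\<in>K. r h \<notin> S \<longrightarrow> P' h = P h \<and> \<phi>' h = \<phi> h)"
    if "S \<subseteq> r ` K" for S
    using finite_subset[OF that fin_r] that
  proof (induction S rule: finite_induct)
    case empty
    then show ?case using stage_axioms extends_refl by fastforce
  next
    case (insert s S)
    then obtain P' \<phi>' c' where st: "stage R f i N K D g P' \<phi>' c'"
      and ext: "extends K D g P \<phi> D g P' \<phi>'"
      and reached: "\<And>h. h \<in> K \<Longrightarrow> r h \<in> S \<Longrightarrow> reached P' \<phi>' h"
      and unchanged: "\<And>h. h \<in> K \<Longrightarrow> r h \<notin> S \<Longrightarrow> P' h = P h \<and> \<phi>' h = \<phi> h"
      by blast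
    obtain h1 where h1: "h1 \<in> K" "r h1 = s" using insert.prems by blast
    define G where "G = {h \<in> K. agree F h1 h}"
    have G_s: "h \<in> G \<longleftrightarrow> r h = s" if "h \<in> K" for h
      using that h1(2) r_agree[of h1 h] by (auto simp: G_def)
    have same: "P' h = P' h1" "u \<in> P' h1 \<Longrightarrow> \<phi>' h u = \<phi>' h1 u" if "h \<in> G" for h u
    proof -
      have h: "h \<in> K" "agree F h1 h" using that by (simp_all add: G_def)
      have "P h1 = P h \<and> (\<forall>u\<in>P h1. \<phi> h1 u = \<phi> h u)"
        using F h h1(1) unfolding controls_def by blast
      moreover have "P' h = P h \<and> \<phi>' h = \<phi> h" "P' h1 = P h1 \<and> \<phi>' h1 = \<phi> h1"
        using unchanged h h1 insert.hyps G_s that by auto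
      ultimately show "P' h = P' h1" "u \<in> P' h1 \<Longrightarrow> \<phi>' h u = \<phi>' h1 u" by auto
    qed
    show ?case
    proof (cases "reached P' \<phi>' h1")
      \<comment> \<open>\<open>P'\<close> and \<open>\<phi>'\<close> are still constant on this
        class, so the orbit is met for all its members.\<close>
      case True
      have "reached P' \<phi>' h" if "h \<in> K" "r h = s" for h
        using True same[of h] G_s that unfolding reached_def by (metis (no_types, lifting))
      then have "\<forall>h\<in>K. r h \<in> insert s S \<longrightarrow> reached P' \<phi>' h" using reached by blast
      then show ?thesis using st ext unchanged by blast
    next
      case False
      interpret st: stage R f i N K D g P' \<phi>' c' by (rule st)
      have q: "(f ^^ k) (\<phi>' h1 u) \<noteq> q \<and> (f ^^ k) q \<noteq> \<phi>' h1 u" if "u \<in> P' h1" for u k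
        using False that unfolding reached_def by blast
      have "P' h1 = P h1" using unchanged h1 insert.hyps by blast
      then have "P' h1 \<subseteq> F" using F h1 by (simp add: controls_def)
      from st.extend_range_class[OF h1(1) fin_F this G_def same q]
      obtain P'' \<phi>'' c'' where st': "stage R f i N K D g P'' \<phi>'' c''"
        and ext': "extends K D g P' \<phi>' D g P'' \<phi>''"
        and G': "\<forall>h\<in>G. q \<in> \<phi>'' h ` P'' h"
        and nG: "\<forall>h\<in>K - G. P'' h = P' h \<and> \<phi>'' h = \<phi>' h"
        by blast
      have "reached P'' \<phi>'' h" if h: "h \<in> K" "r h \<in> insert s S" for h
      proof (cases "h \<in> G")
        case True
        then have "q \<in> \<phi>'' h ` P'' h" using G' by blast
        then obtain u where "u \<in> P'' h" "\<phi>'' h u = q" by auto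
        then have "(f ^^ 0) (\<phi>'' h u) = q" by simp
        then show ?thesis unfolding reached_def using \<open>u \<in> P'' h\<close> by blast
      next
        case False
        then have "reached P' \<phi>' h" using reached h G_s by blast
        then show ?thesis using nG False h by (simp add: reached_def)
      qed
      moreover have "P'' h = P h \<and> \<phi>'' h = \<phi> h" if "h \<in> K" "r h \<notin> insert s S" for h
        using that nG unchanged G_s by auto
      ultimately show ?thesis using st' extends_trans[OF ext ext'] by blast
    qed
  qed
  from this[of "r ` K"] show ?thesis unfolding reached_def by blast
qed

section \<open>Enlarging the domain of \<open>g\<close>, and its image by duality\<close>

lemma extend_domain_of_g:
  "\<exists>D' g' P' \<phi>' c'. stage R f i N K D' g' P' \<phi>' c' \<and> extends K D g P \<phi> D' g' P' \<phi>' \<and> v \<in> D'"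
proof -
  obtain P1 \<phi>1 where st: "stage R f i N K D g P1 \<phi>1 c" and ext: "extends K D g P \<phi> D g P1 \<phi>1"
    and v: "\<forall>h\<in>K. v \<in> P1 h"
    using extend_domain[of v] by blast
  show ?thesis
  proof (cases "v \<in> D")
    case True
    then show ?thesis using st ext by blast
  next
    case False
    interpret st: stage R f i N K D g P1 \<phi>1 c by (rule st)
    obtain g' P' \<phi>' c' where "stage R f i N K (insert v D) g' P' \<phi>' c'"
      "extends K D g P1 \<phi>1 (insert v D) g' P' \<phi>'"
      using st.extend_forward[OF False] v by blast
    then show ?thesis using extends_trans[OF ext] by blast
  qed
qed

text \<open>The equation \<open>\<phi> h \<circ> h \<circ> g = f \<circ> \<phi> h\<close> is equivalent to
  \<open>\<psi> \<circ> inv h \<circ> inv g = inv f \<circ> \<psi>\<close> for \<open>\<psi> = inv f \<circ> \<phi> h \<circ> h\<close>.\<close>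

lemma dual_stage:
  "stage R (inv f) i N (inv ` K) (g ` D) (inv_into D g) (\<lambda>k. k ` P (inv k))
    (\<lambda>k y. inv f (\<phi> (inv k) (inv k y))) (\<lambda>y v. c v y)"
proof -
  interpret dual: setting R "inv f" i N "inv ` K" by (rule dual_setting)
  have ii: "inv (inv h) = h" if "h \<in> K" for h
    using K_bij[OF that] by (rule inv_inv_eq)
  have g_inv: "inv_into D g (g v) = v" if "v \<in> D" for v
    using g_inj that by simp
  have mem: "y \<in> inv h ` P h \<longleftrightarrow> h y \<in> P h" if h: "h \<in> K" for h y
  proof
    assume "h y \<in> P h"
    then have "inv h (h y) \<in> inv h ` P h" by blast
    then show "y \<in> inv h ` P h" using h by (simp add: K_simps)
  next
    assume "y \<in> inv h ` P h"
    then show "h y \<in> P h" using K_simps(2)[OF h] by auto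
  qed
  have image_D: "inv_into D g ` g ` D = D"
    using g_inv by (simp add: image_image)
  have inv_rel: "R (inv f a) (inv f b) \<longleftrightarrow> R a b" for a b
    using Aut_rel[OF Aut_inv[OF f_Aut]] .
  have inv_eq: "inv f a = inv f b \<longleftrightarrow> a = b" for a b
    using Aut_eq_iff[OF Aut_inv[OF f_Aut]] .
  \<comment> \<open>A backward relation for the dual maps is a forward relation with the endpoints
    exchanged. Hence \<open>orbit_source\<close> and \<open>orbit_target\<close> trade
    places.\<close>
  have orb: "v \<in> D \<and> u \<in> g ` D"
    if h: "h \<in> K" and u: "h u \<in> P h" and v: "v \<in> P h"
      and eq: "inv f (\<phi> h v) = (inv f ^^ Suc k) (inv f (\<phi> h (h u)))" for h u v k
  proof -
    have "inv f (\<phi> h (h u)) = (f ^^ Suc k) (inv f (\<phi> h v))"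
      using Aut_funpow_inv[OF f_Aut] eq by metis
    then have "f (inv f (\<phi> h (h u))) = (f ^^ Suc k) (f (inv f (\<phi> h v)))"
      by (simp add: funpow_swap1)
    then have "\<phi> h (h u) = (f ^^ Suc k) (\<phi> h v)" by (simp only: f_simps)
    then show ?thesis
      using orbit_source[OF h u v] orbit_target[OF h u v] K_simps(1)[OF h] by metis
  qed
  show ?thesis
  proof unfold_locales
    show "finite (g ` D)" using finite_D by simp
    show "N \<subseteq> g ` D" using N_D g_N by force
    show "inv_into D g v = v" if "v \<in> N" for v
      using that N_D g_N g_inv by (metis subsetD)
    show "inj_on (inv_into D g) (g ` D)" by (rule inj_on_inv_into) simp
    show "R (inv_into D g u) (inv_into D g v) \<longleftrightarrow> R u v" if "u \<in> g ` D" "v \<in> g ` D" for u v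
      using that g_rel g_inv by auto
    fix k assume "k \<in> inv ` K"
    then obtain h where h: "h \<in> K" and k: "k = inv h" by blast
    have ik: "inv k = h" using ii[OF h] k by simp
    note m = mem[OF h]
    show "inv f (\<phi> (inv k) (inv k v)) = v" if "v \<in> N" for v
      unfolding ik using that \<phi>_N[OF h] K_N[OF h] f_in_N f_simps by simp
    show "inj_on (\<lambda>y. inv f (\<phi> (inv k) (inv k y))) (k ` P (inv k))"
      unfolding ik unfolding k
      by (rule inj_onI) (metis m inv_eq \<phi>_inj[OF h] inj_onD K_simps(3)[OF h])
    show "R (inv f (\<phi> (inv k) (inv k u))) (inv f (\<phi> (inv k) (inv k v))) \<longleftrightarrow> R u v"
      if "u \<in> k ` P (inv k)" "v \<in> k ` P (inv k)" for u v
      using that unfolding ik unfolding k m inv_rel using \<phi>_rel[OF h] K_simps(4)[OF h] by simp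
    show "g ` D \<subseteq> k ` P (inv k)"
      unfolding ik unfolding k using m hg_P[OF h] by blast
    show "k (inv_into D g v) \<in> k ` P (inv k)" if "v \<in> g ` D" for v
      unfolding ik using that g_inv D_P[OF h] by auto
    show "inv f (\<phi> (inv k) (inv k (k (inv_into D g v)))) = inv f (inv f (\<phi> (inv k) (inv k v)))"
      if v: "v \<in> g ` D" for v
      unfolding ik unfolding k using v g_inv equivariant[OF h] K_simps(2)[OF h] f_simps by auto
    show "v \<in> g ` D"
      if "u \<in> k ` P (inv k)" "v \<in> k ` P (inv k)"
        "inv f (\<phi> (inv k) (inv k u)) = (inv f ^^ Suc n) (inv f (\<phi> (inv k) (inv k v)))" for u v n
      using that unfolding ik unfolding k m using orb[OF h, of v "h u" n] by blast
    show "inv k u \<in> inv_into D g ` g ` D"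
      if "u \<in> k ` P (inv k)" "v \<in> k ` P (inv k)"
        "inv f (\<phi> (inv k) (inv k u)) = (inv f ^^ Suc n) (inv f (\<phi> (inv k) (inv k v)))" for u v n
      using that unfolding ik unfolding k m image_D using orb[OF h, of v "h u" n] by blast
    show "R (inv f (inv f (\<phi> (inv k) (inv k v)))) (inv f (\<phi> (inv k) (inv k (k y)))) \<longleftrightarrow> c y v"
      if v: "v \<in> k ` P (inv k)" "v \<notin> g ` D"
        and y: "k y \<in> k ` P (inv k)" "y \<notin> inv_into D g ` g ` D" for v y
    proof -
      have "y \<in> P h" using y(1) unfolding ik unfolding k m by (simp add: K_simps h)
      then have "R (f (\<phi> h y)) (\<phi> h (h v)) \<longleftrightarrow> c y v"
        using coherent[OF h, of y v] v y(2) unfolding ik unfolding k m image_D by blast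
      \<comment> \<open>Applying \<open>f\<close> twice gives the original constraint with its two
        vertices exchanged, which explains the transposed \<open>c\<close>.\<close>
      moreover have "R (inv f (inv f (\<phi> h (h v)))) (inv f (\<phi> h y)) \<longleftrightarrow> R (f (\<phi> h y)) (\<phi> h (h v))"
        using inv_rel f_simps rel_commute by metis
      ultimately show ?thesis unfolding ik unfolding k by (simp add: K_simps h)
    qed
    show "c v (k v) = i" if "k v \<notin> k ` P (inv k)" for v
      using that default[OF h, of "inv h v"] unfolding ik unfolding k m by (simp add: K_simps h)
  next
    obtain F where F: "controls K P \<phi> F" using controlled by blast
    have "controls (inv ` K) (\<lambda>k. k ` P (inv k)) (\<lambda>k y. inv f (\<phi> (inv k) (inv k y))) F"
      unfolding controls_def
    proof (intro conjI ballI impI)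
      show "finite F" using F by (simp add: controls_def)
      fix k assume "k \<in> inv ` K"
      then obtain h where h: "h \<in> K" and k: "k = inv h" by blast
      have ik: "inv k = h" using ii[OF h] k by simp
      have P_F: "P h \<subseteq> F" "inv h ` P h \<subseteq> F" using F h by (simp_all add: controls_def)
      show "k ` P (inv k) \<subseteq> F" unfolding ik unfolding k by (rule P_F)
      show "inv k ` k ` P (inv k) \<subseteq> F"
        unfolding ik unfolding k using P_F(1) by (simp add: image_image K_simps h)
      fix k' assume "k' \<in> inv ` K" and ag: "agree F k k'"
      then obtain h' where h': "h' \<in> K" and k': "k' = inv h'" by blast
      have ik': "inv k' = h'" using ii[OF h'] k' by simp
      have ag': "agree F h h'"
        using ag unfolding agree_def ik ik' unfolding k k' by blast
      then have same: "P h = P h'" "\<And>u. u \<in> P h \<Longrightarrow> \<phi> h u = \<phi> h' u"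
        using F h h' unfolding controls_def by blast+
      show "k ` P (inv k) = k' ` P (inv k')"
        unfolding ik ik' same(1)[symmetric] unfolding k k'
        using ag' P_F(1) by (intro image_cong) (auto simp: agree_def)
      show "inv f (\<phi> (inv k) (inv k y)) = inv f (\<phi> (inv k') (inv k' y))"
        if "y \<in> k ` P (inv k)" for y
      proof -
        have "y \<in> inv h ` P h" using that unfolding ik unfolding k .
        then have "h y \<in> P h" "h y = h' y"
          using mem[OF h] ag' P_F(2) by (auto simp: agree_def)
        then show ?thesis unfolding ik ik' using same(2) by metis
      qed
    qed
    then show "\<exists>F. controls (inv ` K) (\<lambda>k. k ` P (inv k)) (\<lambda>k y. inv f (\<phi> (inv k) (inv k y))) F"
      by blast
  qed
qed

text \<open>Enlarges the domain of the inverse of \<open>g\<close> in the dual problem and dualises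
  back. Dualising twice restores the old values, as \<open>f\<close> cancels \<open>inv f\<close>
  and \<open>h\<close> cancels \<open>inv h\<close>.\<close>

lemma extend_image_of_g:
  "\<exists>D' g' P' \<phi>' c'. stage R f i N K D' g' P' \<phi>' c' \<and> extends K D g P \<phi> D' g' P' \<phi>' \<and> v \<in> g' ` D'"
proof -
  define P1 where "P1 = (\<lambda>k. k ` P (inv k))"
  define \<phi>1 where "\<phi>1 = (\<lambda>k y. inv f (\<phi> (inv k) (inv k y)))"
  interpret dual: stage R "inv f" i N "inv ` K" "g ` D" "inv_into D g" P1 \<phi>1 "\<lambda>y v. c v y"
    unfolding P1_def \<phi>1_def by (rule dual_stage)
  obtain D' g' P' \<phi>' c' where st: "stage R (inv f) i N (inv ` K) D' g' P' \<phi>' c'"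
    and ext: "extends (inv ` K) (g ` D) (inv_into D g) P1 \<phi>1 D' g' P' \<phi>'" and v: "v \<in> D'"
    using dual.extend_domain_of_g by blast
  interpret st: stage R "inv f" i N "inv ` K" D' g' P' \<phi>' c' by (rule st)
  define P2 where "P2 = (\<lambda>k. k ` P' (inv k))"
  define \<phi>2 where "\<phi>2 = (\<lambda>k y. inv (inv f) (\<phi>' (inv k) (inv k y)))"
  have "inv (inv f) = f" using f_bij by (rule inv_inv_eq)
  have "inv ` inv ` K = K" using K_bij by (force simp: inv_inv_eq image_image)
  have "stage R f i N K (g' ` D') (inv_into D' g') P2 \<phi>2 (\<lambda>y v. c' v y)"
    using st.dual_stage unfolding P2_def \<phi>2_def \<open>inv (inv f) = f\<close> \<open>inv ` inv ` K = K\<close> .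
  moreover have "extends K D g P \<phi> (g' ` D') (inv_into D' g') P2 \<phi>2"
    unfolding extends_def
  proof (intro conjI ballI)
    have g': "g v \<in> D'" "g' (g v) = v" if "v \<in> D" for v
      using ext that g_inj by (auto simp: extends_def)
    then show "D \<subseteq> g' ` D'" by force
    show "inv_into D' g' v = g v" if "v \<in> D" for v
      using inv_into_f_f[OF st.g_inj g'(1)[OF that]] g'(2)[OF that] by simp
    fix h assume h: "h \<in> K"
    have ii: "inv (inv h) = h" using K_bij[OF h] by (rule inv_inv_eq)
    have P1: "P1 (inv h) = inv h ` P h" by (simp add: P1_def ii)
    have sub: "P1 (inv h) \<subseteq> P' (inv h)" and eq: "\<And>y. y \<in> P1 (inv h) \<Longrightarrow> \<phi>' (inv h) y = \<phi>1 (inv h) y"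
      using ext h by (auto simp: extends_def)
    show "P h \<subseteq> P2 h"
    proof
      fix u assume "u \<in> P h"
      then have "inv h u \<in> P' (inv h)" using sub P1 by blast
      then have "h (inv h u) \<in> P2 h" unfolding P2_def by blast
      then show "u \<in> P2 h" by (simp add: K_simps h)
    qed
    show "\<phi>2 h u = \<phi> h u" if "u \<in> P h" for u
    proof -
      have "\<phi>' (inv h) (inv h u) = inv f (\<phi> h (h (inv h u)))"
        using eq[of "inv h u"] P1 that by (simp add: \<phi>1_def ii)
      then show ?thesis
        by (simp add: \<phi>2_def \<open>inv (inv f) = f\<close> f_simps K_simps h)
    qed
  qed
  moreover have "v \<in> inv_into D' g' ` g' ` D'"
    using v st.g_inj by (simp add: image_image)
  ultimately show ?thesis by blast
qed

text \<open>One round of the back-and-forth. The domains of the maps \<open>\<phi> h\<close> need no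
  separate treatment, since they contain \<open>D\<close>.\<close>

lemma extend_all:
  "\<exists>D' g' P' \<phi>' c'. stage R f i N K D' g' P' \<phi>' c' \<and> extends K D g P \<phi> D' g' P' \<phi>' \<and>
    v \<in> D' \<and> v \<in> g' ` D' \<and>
    (\<forall>h\<in>K. \<exists>u\<in>P' h. \<exists>k. (f ^^ k) (\<phi>' h u) = v \<or> (f ^^ k) v = \<phi>' h u)"
proof -
  obtain D1 g1 P1 \<phi>1 c1 where 1: "stage R f i N K D1 g1 P1 \<phi>1 c1" "extends K D g P \<phi> D1 g1 P1 \<phi>1"
    "v \<in> D1"
    using extend_domain_of_g by blast
  interpret s1: stage R f i N K D1 g1 P1 \<phi>1 c1 by (rule 1)
  obtain D2 g2 P2 \<phi>2 c2 where 2: "stage R f i N K D2 g2 P2 \<phi>2 c2"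
    "extends K D1 g1 P1 \<phi>1 D2 g2 P2 \<phi>2" "v \<in> g2 ` D2"
    using s1.extend_image_of_g by blast
  interpret s2: stage R f i N K D2 g2 P2 \<phi>2 c2 by (rule 2)
  obtain P3 \<phi>3 c3 where 3: "stage R f i N K D2 g2 P3 \<phi>3 c3" "extends K D2 g2 P2 \<phi>2 D2 g2 P3 \<phi>3"
    "\<forall>h\<in>K. \<exists>u\<in>P3 h. \<exists>k. (f ^^ k) (\<phi>3 h u) = v \<or> (f ^^ k) v = \<phi>3 h u"
    using s2.extend_range by blast
  have "v \<in> D2" using 1(3) 2(2) unfolding extends_def by blast
  then show ?thesis
    using 3 2(3) extends_trans[OF extends_trans[OF 1(2) 2(2)] 3(2)] by blast
qed

end

subsection \<open>The limit\<close>

text \<open>Equivariance on \<open>N\<close> is the hypothesis that \<open>h\<close> and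
  \<open>f\<close> agree there. With \<open>P h = D\<close>, coherence is vacuous, and the constant
  \<open>i\<close> satisfies \<open>default\<close>.\<close>

lemma (in setting) initial_stage: "stage R f i N K N id (\<lambda>_. N) (\<lambda>_. id) (\<lambda>_ _. i)"
proof unfold_locales
  have in_N: "h v \<in> N" "inv h v \<in> N" if "h \<in> K" "v \<in> N" for h v
    using that K_N inv_K_N f_in_N inv_f_N by simp_all
  have "controls K (\<lambda>_. N) (\<lambda>_. id) N"
    using finite_N in_N by (auto simp: controls_def)
  then show "\<exists>F. controls K (\<lambda>_. N) (\<lambda>_. id) F" by blast
  show "h (id v) \<in> N" if "h \<in> K" "v \<in> N" for h v using in_N that by simp
  show "inv h u \<in> id ` N" if "h \<in> K" "u \<in> N" for h u using in_N that by simp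
qed (use finite_N K_N in auto)

lemma (in setting) conjugators_exist:
  "\<exists>g\<in>Aut R. \<exists>\<phi>. (\<forall>v\<in>N. g v = v) \<and>
    (\<forall>h\<in>K. \<phi> h \<in> Aut R \<and> (\<forall>v\<in>N. \<phi> h v = v) \<and> \<phi> h \<circ> h \<circ> g = f \<circ> \<phi> h)"
proof -
  define e where "e = from_nat_into (UNIV :: 'v set)"
  have e: "\<exists>n. e n = v" for v
    using from_nat_into_surj[OF countable_vertices, of v] by (auto simp: e_def)
  \<comment> \<open>The function \<open>c\<close> is bound inside: it may be rewritten from stage to
    stage and has no limit, unlike \<open>g\<close> and \<open>\<phi>\<close>.\<close>
  let ?good = "\<lambda>(D, g, P, \<phi>). \<exists>c. stage R f i N K D g P \<phi> c"
  let ?step = "\<lambda>n (D, g, P, \<phi>) (D', g', P', \<phi>'). extends K D g P \<phi> D' g' P' \<phi>' \<and>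
    e n \<in> D' \<and> e n \<in> g' ` D' \<and>
    (\<forall>h\<in>K. \<exists>u\<in>P' h. \<exists>k. (f ^^ k) (\<phi>' h u) = e n \<or> (f ^^ k) (e n) = \<phi>' h u)"
  have "\<exists>S. \<forall>n. ?good (S n) \<and> ?step n (S n) (S (Suc n))"
  proof (rule dependent_nat_choice)
    show "\<exists>s. ?good s" using initial_stage by (intro exI[of _ "(N, id, \<lambda>_. N, \<lambda>_. id)"]) auto
    fix s n assume "?good s"
    moreover obtain D g P \<phi> where s: "s = (D, g, P, \<phi>)" by (cases s)
    ultimately obtain c where "stage R f i N K D g P \<phi> c" by auto
    then interpret stage R f i N K D g P \<phi> c .
    obtain D' g' P' \<phi>' c' where "stage R f i N K D' g' P' \<phi>' c'" "?step n s (D', g', P', \<phi>')"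
      using extend_all[of "e n"] unfolding s by auto
    then show "\<exists>t. ?good t \<and> ?step n s t" by (intro exI[of _ "(D', g', P', \<phi>')"]) auto
  qed
  then obtain S where S: "\<forall>n. ?good (S n) \<and> ?step n (S n) (S (Suc n))" ..
  define D where "D n = fst (S n)" for n
  define g where "g n = fst (snd (S n))" for n
  define P where "P n = fst (snd (snd (S n)))" for n
  define \<phi> where "\<phi> n = snd (snd (snd (S n)))" for n
  have S_eq: "S n = (D n, g n, P n, \<phi> n)" for n by (simp add: D_def g_def P_def \<phi>_def)
  obtain c where st: "\<And>n. stage R f i N K (D n) (g n) (P n) (\<phi> n) (c n)"
    using S unfolding S_eq prod.case by metis
  have ext_Suc: "extends K (D n) (g n) (P n) (\<phi> n) (D (Suc n)) (g (Suc n)) (P (Suc n)) (\<phi> (Suc n))"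
    and e_D: "e n \<in> D (Suc n)" and e_g: "e n \<in> g (Suc n) ` D (Suc n)"
    and e_\<phi>: "h \<in> K \<Longrightarrow> \<exists>u\<in>P (Suc n) h. \<exists>k. (f ^^ k) (\<phi> (Suc n) h u) = e n \<or>
      (f ^^ k) (e n) = \<phi> (Suc n) h u" for n h
    using S[rule_format, of n] unfolding S_eq prod.case by blast+
  have ext: "extends K (D m) (g m) (P m) (\<phi> m) (D n) (g n) (P n) (\<phi> n)" if "m \<le> n" for m n
    using that
  proof (induction n rule: dec_induct)
    case base
    show ?case by (rule extends_refl)
  next
    case (step n)
    then show ?case using extends_trans ext_Suc by blast
  qed
  \<comment> \<open>The value at the first stage where it exists; by \<open>ext\<close> every later
    stage gives the same one.\<close>
  define G where "G v = g (LEAST n. v \<in> D n) v" for v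
  define \<Phi> where "\<Phi> h u = \<phi> (LEAST n. u \<in> P n h) h u" for h u
  have G: "g n v = G v" if v: "v \<in> D n" for n v
  proof -
    have "v \<in> D (LEAST n. v \<in> D n)" "(LEAST n. v \<in> D n) \<le> n"
      using v by (rule LeastI, rule Least_le)
    then show ?thesis using ext unfolding G_def extends_def by blast
  qed
  have \<Phi>: "\<phi> n h u = \<Phi> h u" if h: "h \<in> K" and u: "u \<in> P n h" for n h u
  proof -
    have "u \<in> P (LEAST n. u \<in> P n h) h" "(LEAST n. u \<in> P n h) \<le> n"
      using u by (rule LeastI, rule Least_le)
    then show ?thesis using ext h unfolding \<Phi>_def extends_def by blast
  qed
  have mono_D: "D m \<subseteq> D n" if "m \<le> n" for m n
    using ext[OF that] by (simp add: extends_def)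
  have D_P: "D n \<subseteq> P n h" if "h \<in> K" for n h
    using stage.D_P[OF st that] .
  have in_D: "\<exists>n. u \<in> D n \<and> v \<in> D n" for u v
  proof -
    obtain a b where "e a = u" "e b = v" using e by metis
    then have "u \<in> D (Suc a)" "v \<in> D (Suc b)" using e_D by blast+
    then show ?thesis
      using mono_D[of "Suc a" "max (Suc a) (Suc b)"] mono_D[of "Suc b" "max (Suc a) (Suc b)"] by auto
  qed
  have G_Aut: "G \<in> Aut R"
  proof -
    have "inj G"
    proof (rule injI)
      fix u v assume "G u = G v"
      moreover obtain n where n: "u \<in> D n" "v \<in> D n" using in_D by blast
      ultimately show "u = v" using inj_onD[OF stage.g_inj[OF st] _ n] G[OF n(1)] G[OF n(2)] by simp
    qed
    moreover have "surj G"
      unfolding surj_def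
    proof
      fix w
      obtain n where "e n = w" using e by blast
      then obtain v where "v \<in> D (Suc n)" "w = g (Suc n) v" using e_g[of n] by blast
      then show "\<exists>v. w = G v" using G by blast
    qed
    moreover have "R (G u) (G v) \<longleftrightarrow> R u v" for u v
    proof -
      obtain n where n: "u \<in> D n" "v \<in> D n" using in_D by blast
      then show ?thesis using stage.g_rel[OF st n] G by simp
    qed
    ultimately show ?thesis by (simp add: Aut_def bij_def)
  qed
  have G_N: "G v = v" if "v \<in> N" for v
    using G[of v 0] stage.g_N[OF st that, of 0] stage.N_D[OF st, of 0] that by auto
  have \<Phi>_conj: "\<Phi> h (h (G v)) = f (\<Phi> h v)" if h: "h \<in> K" for h v
  proof -
    obtain n where v: "v \<in> D n" using in_D by blast
    have "\<phi> n h (h (g n v)) = f (\<phi> n h v)" by (rule stage.equivariant[OF st h v])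
    moreover have "v \<in> P n h" using D_P[OF h] v by blast
    ultimately show ?thesis
      using \<Phi>[OF h] stage.hg_P[OF st h v] G[OF v] by simp
  qed
  have \<Phi>_Aut: "\<Phi> h \<in> Aut R" if h: "h \<in> K" for h
  proof -
    have in_P: "\<exists>n. u \<in> P n h \<and> v \<in> P n h" for u v
      using in_D[of u v] D_P[OF h] by blast
    have "inj (\<Phi> h)"
    proof (rule injI)
      fix u v assume "\<Phi> h u = \<Phi> h v"
      moreover obtain n where n: "u \<in> P n h" "v \<in> P n h" using in_P by blast
      ultimately show "u = v"
        using inj_onD[OF stage.\<phi>_inj[OF st h] _ n] \<Phi>[OF h n(1)] \<Phi>[OF h n(2)] by simp
    qed
    moreover have "R (\<Phi> h u) (\<Phi> h v) \<longleftrightarrow> R u v" for u v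
    proof -
      obtain n where n: "u \<in> P n h" "v \<in> P n h" using in_P by blast
      then show ?thesis using stage.\<phi>_rel[OF st h n] \<Phi>[OF h n(1)] \<Phi>[OF h n(2)] by simp
    qed
    moreover have "q \<in> range (\<Phi> h)" for q
    proof -
      obtain n where n: "e n = q" using e by blast
      obtain u k where u: "u \<in> P (Suc n) h"
        "(f ^^ k) (\<phi> (Suc n) h u) = q \<or> (f ^^ k) q = \<phi> (Suc n) h u"
        using e_\<phi>[OF h, of n] n by blast
      \<comment> \<open>The range is closed under \<open>f\<close> because \<open>G\<close> is
        total, and under \<open>inv f\<close> because \<open>G\<close> and \<open>h\<close> are
        onto. So meeting the orbit of \<open>q\<close> suffices.\<close>
      have forward: "(f ^^ k) (\<Phi> h u) \<in> range (\<Phi> h)" for k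
      proof (induction k)
        case (Suc k)
        then obtain v where "(f ^^ k) (\<Phi> h u) = \<Phi> h v" by blast
        then have "(f ^^ Suc k) (\<Phi> h u) = \<Phi> h (h (G v))" using \<Phi>_conj[OF h] by simp
        then show ?case by blast
      qed simp
      have backward: "q \<in> range (\<Phi> h)" if "(f ^^ k) q \<in> range (\<Phi> h)" for k q
        using that
      proof (induction k)
        case (Suc k)
        then obtain u where u: "f ((f ^^ k) q) = \<Phi> h u" by auto
        have "u = h (G (inv G (inv h u)))"
          using Aut_inv_right[OF G_Aut] K_simps(2)[OF h] by simp
        then have "f ((f ^^ k) q) = f (\<Phi> h (inv G (inv h u)))"
          using u \<Phi>_conj[OF h] by metis
        then have "(f ^^ k) q = \<Phi> h (inv G (inv h u))" using f_simps(3) by blast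
        then have "(f ^^ k) q \<in> range (\<Phi> h)" by simp
        then show ?case by (rule Suc.IH)
      qed simp
      from u(2) show ?thesis unfolding \<Phi>[OF h u(1)]
      proof
        assume "(f ^^ k) (\<Phi> h u) = q"
        then show ?thesis using forward[of k] by simp
      next
        assume "(f ^^ k) q = \<Phi> h u"
        then show ?thesis using backward[of k q] by simp
      qed
    qed
    then have "surj (\<Phi> h)" by blast
    ultimately show ?thesis by (simp add: Aut_def bij_def)
  qed
  have \<Phi>_N: "\<Phi> h v = v" if "h \<in> K" "v \<in> N" for h v
    using \<Phi>[of h v 0] stage.\<phi>_N[OF st that, of 0] stage.N_P[OF st, of h 0] that by auto
  show ?thesis
    using G_Aut G_N \<Phi>_Aut \<Phi>_N \<Phi>_conj
    by (intro bexI[of _ G] exI[of _ \<Phi>]) (auto simp: fun_eq_iff)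
qed

subsection \<open>Orbits and compact sets of automorphisms\<close>

text \<open>A negative power leading from \<open>v\<close> to \<open>w\<close> is a natural power
  leading from \<open>w\<close> to \<open>v\<close>, so integers and \<open>inv f\<close> can be
  eliminated.\<close>

lemma int_iterate_iff:
  assumes "f \<in> Aut R"
  shows "(\<exists>j. int_iterate f j v = w) \<longleftrightarrow> (\<exists>k. (f ^^ k) v = w \<or> (f ^^ k) w = v)"
proof
  assume "\<exists>j. int_iterate f j v = w"
  then show "\<exists>k. (f ^^ k) v = w \<or> (f ^^ k) w = v"
    using Aut_funpow_inv[OF assms] unfolding int_iterate_def by metis
next
  assume "\<exists>k. (f ^^ k) v = w \<or> (f ^^ k) w = v"
  then obtain k where "(f ^^ k) v = w \<or> (f ^^ k) w = v" by blast
  then show "\<exists>j. int_iterate f j v = w"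
  proof
    assume "(f ^^ k) v = w"
    then have "int_iterate f (int k) v = w" by (simp add: int_iterate_def)
    then show ?thesis ..
  next
    assume "(f ^^ k) w = v"
    then have "(inv f ^^ k) v = w" using Aut_funpow_inv[OF assms] by metis
    then have "int_iterate f (- int k) v = w" by (cases "k = 0") (simp_all add: int_iterate_def)
    then show ?thesis ..
  qed
qed

lemma orbit_of_set_eq:
  assumes "f \<in> Aut R"
  shows "orbit_of_set f A = {w. \<exists>v\<in>A. \<exists>k. (f ^^ k) v = w \<or> (f ^^ k) w = v}"
  unfolding orbit_of_set_def by (auto simp: int_iterate_iff[OF assms, symmetric])

lemma orbit_closed:
  assumes f: "f \<in> Aut R"
  shows "f w \<in> orbit_of_set f {v} \<longleftrightarrow> w \<in> orbit_of_set f {v}"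
proof -
  have "(\<exists>k. (f ^^ k) v = f w \<or> (f ^^ k) (f w) = v) \<longleftrightarrow> (\<exists>k. (f ^^ k) v = w \<or> (f ^^ k) w = v)"
    (is "?L \<longleftrightarrow> ?R")
  proof
    assume ?L
    then obtain k where "(f ^^ k) v = f w \<or> (f ^^ Suc k) w = v" by (auto simp: funpow_swap1)
    then show ?R
    proof
      assume k: "(f ^^ k) v = f w"
      show ?R
      proof (cases k)
        \<comment> \<open>With exponent zero the relation changes direction and needs one forward
          step.\<close>
        case 0
        then have "(f ^^ Suc 0) w = v" using k by simp
        then show ?R by blast
      next
        case (Suc m)
        then have "(f ^^ m) v = w" using k by (simp add: Aut_eq_iff[OF f])
        then show ?R by blast
      qed
    qed blast
  next
    assume ?R
    then obtain k where "(f ^^ Suc k) v = f w \<or> (f ^^ k) w = v" by (auto simp: Aut_eq_iff[OF f])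
    then show ?L
    proof
      assume k: "(f ^^ k) w = v"
      show ?L
      proof (cases k)
        case 0
        then have "(f ^^ Suc 0) v = f w" using k by simp
        then show ?L by blast
      next
        case (Suc m)
        then have "(f ^^ m) (f w) = v" using k by (simp add: funpow_swap1)
        then show ?L by blast
      qed
    qed blast
  qed
  then show ?thesis by (simp add: orbit_of_set_eq[OF f])
qed

lemma orbit_self:
  assumes f: "f \<in> Aut R"
  shows "v \<in> orbit_of_set f {v}"
  unfolding orbit_of_set_eq[OF f] by (auto intro: exI[of _ 0])

lemma orbit_subset:
  assumes f: "f \<in> Aut R" and v: "v \<in> orbit_of_set f {u}"
  shows "orbit_of_set f {v} \<subseteq> orbit_of_set f {u}"
proof
  have closed: "(f ^^ k) w \<in> orbit_of_set f {u} \<longleftrightarrow> w \<in> orbit_of_set f {u}" for k w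
    by (induction k) (simp_all add: orbit_closed[OF f])
  fix w assume "w \<in> orbit_of_set f {v}"
  then obtain k where "(f ^^ k) v = w \<or> (f ^^ k) w = v"
    by (auto simp: orbit_of_set_eq[OF f])
  then show "w \<in> orbit_of_set f {u}" using v closed by metis
qed

text \<open>Each vertex of a finite orbit has its own orbit inside that orbit, and each vertex
  belongs to its own orbit.\<close>

lemma finite_orbits_union_eq:
  assumes f: "f \<in> Aut R"
  shows "finite_orbits_union f = {v. finite (orbit_of_set f {v})}"
proof
  show "finite_orbits_union f \<subseteq> {v. finite (orbit_of_set f {v})}"
    unfolding finite_orbits_union_def orbits_def
    using orbit_subset[OF f] by (auto intro: finite_subset)
  show "{v. finite (orbit_of_set f {v})} \<subseteq> finite_orbits_union f"
    unfolding finite_orbits_union_def orbits_def using orbit_self[OF f] by blast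
qed

lemma periodic_orbit_finite:
  assumes f: "f \<in> Aut R" and p: "(f ^^ Suc k) p = p"
  shows "finite (orbit_of_set f {p})"
proof -
  have forward: "(f ^^ m) p \<in> (\<lambda>m. (f ^^ m) p) ` {..k}" for m
  proof -
    have "(f ^^ m) p = (f ^^ (m mod Suc k)) p"
      using funpow_mod_eq[OF p] by simp
    moreover have "m mod Suc k \<le> k" by (simp add: less_Suc_eq_le[symmetric])
    ultimately show ?thesis by blast
  qed
  have "orbit_of_set f {p} \<subseteq> (\<lambda>m. (f ^^ m) p) ` {..k}"
  proof
    fix w assume "w \<in> orbit_of_set f {p}"
    then obtain m where "(f ^^ m) p = w \<or> (f ^^ m) w = p"
      by (auto simp: orbit_of_set_eq[OF f])
    then show "w \<in> (\<lambda>m. (f ^^ m) p) ` {..k}"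
    proof
      assume m: "(f ^^ m) w = p"
      \<comment> \<open>Going round the cycle \<open>m\<close> times turns the \<open>m\<close>-th
        backward iterate into the forward iterate with exponent \<open>m * k\<close>.\<close>
      have "(f ^^ (m * Suc k)) p = p"
        using funpow_mod_eq[OF p, of "m * Suc k"] by (simp del: mult_Suc_right)
      then have "(f ^^ m) ((f ^^ (m * k)) p) = (f ^^ m) w"
        using m by (simp add: funpow_add)
      then have "w = (f ^^ (m * k)) p" by (simp add: Aut_funpow_eq_iff[OF f])
      then show ?thesis using forward by blast
    qed (use forward in blast)
  qed
  then show ?thesis by (rule finite_subset) simp
qed

section \<open>Pointwise finiteness from compactness\<close>

lemma openin_Aut_topology: "openin (Aut_topology R) {h \<in> Aut R. h a = b}"
proof -
  let ?T = "product_topology (\<lambda>_. discrete_topology UNIV) UNIV :: ('a \<Rightarrow> 'a) topology"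
  have "continuous_map ?T (discrete_topology UNIV) (\<lambda>h. h a)"
    by (rule continuous_map_product_projection) simp
  then have "openin ?T {h \<in> topspace ?T. h a \<in> {b}}"
    by (rule openin_continuous_map_preimage) simp
  then have "openin ?T {h. h a = b}" by simp
  moreover have "{h \<in> Aut R. h a = b} = {h. h a = b} \<inter> Aut R" by blast
  ultimately show ?thesis
    unfolding Aut_topology_def openin_subtopology by blast
qed

text \<open>The fibres of \<open>t\<close> form an open cover of \<open>K\<close>. A finite subcover
  leaves only finitely many values.\<close>

lemma compactin_Aut_finite:
  assumes K: "compactin (Aut_topology R) K" and t: "\<And>h. h \<in> Aut R \<Longrightarrow> t h \<in> A"
    and o: "\<And>a. a \<in> A \<Longrightarrow> openin (Aut_topology R) {h \<in> Aut R. t h = a}"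
  shows "finite (t ` K)"
proof -
  have K_Aut: "K \<subseteq> Aut R"
    using K unfolding compactin_def Aut_topology_def by auto
  let ?U = "(\<lambda>a. {h \<in> Aut R. t h = a}) ` A"
  have "K \<subseteq> \<Union> ?U" using K_Aut t by blast
  then obtain \<F> where \<F>: "finite \<F>" "\<F> \<subseteq> ?U" "K \<subseteq> \<Union> \<F>"
    using compactinD[OF K, of ?U] o by blast
  obtain B where B: "finite B" "\<F> = (\<lambda>a. {h \<in> Aut R. t h = a}) ` B"
    using finite_subset_image[OF \<F>(1,2)] by blast
  have "t ` K \<subseteq> B" using \<F>(3) B(2) by blast
  then show ?thesis using B(1) by (rule finite_subset)
qed

theorem theorem2p6:
  fixes R :: "'v \<Rightarrow> 'v \<Rightarrow> bool"
    and f :: "'v \<Rightarrow> 'v"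
    and K :: "('v \<Rightarrow> 'v) set"
    and N :: "'v set"
  assumes "random_graph R"
    and "f \<in> Aut R"
    and "star_property R False f \<or> star_property R True f"
    and "N = finite_orbits_union f"
    and "compactin (Aut_topology R) K"
    and "\<forall>h\<in>K. \<forall>v\<in>N. h v = f v"
  shows "translatable_into R K (conjugacy_class R f) \<and>
    (\<exists>g\<in>Aut R. \<exists>\<phi> :: ('v \<Rightarrow> 'v) \<Rightarrow> 'v \<Rightarrow> 'v.
      (\<forall>v\<in>N. g v = v) \<and>
      (\<forall>h\<in>K. \<phi> h \<in> Aut R \<and> (\<forall>v\<in>N. \<phi> h v = v) \<and> \<phi> h \<circ> h \<circ> g = f \<circ> \<phi> h))"
proof -
  note f = assms(2)
  obtain i where star: "star_property R i f" using assms(3) by blast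
  have N: "N = {v. finite (orbit_of_set f {v})}"
    using assms(4) finite_orbits_union_eq[OF f] by simp
  have K_Aut: "K \<subseteq> Aut R"
    using assms(5) unfolding compactin_def Aut_topology_def by auto
  interpret random_graph R by (rule assms(1))
  interpret setting R f i N K
  proof
    show "f \<in> Aut R" by (rule f)
    show "finite N"
      using star unfolding assms(4) star_property_def finite_orbits_union_def by auto
    show "f ` N = N"
    proof
      have eq: "orbit_of_set f {f v} = orbit_of_set f {v}" for v
        using orbit_closed[OF f] orbit_self[OF f] orbit_subset[OF f] by (metis subset_antisym)
      show "f ` N \<subseteq> N" unfolding N using eq by auto
      show "N \<subseteq> f ` N"
      proof
        fix v assume "v \<in> N"
        then have "inv f v \<in> N"
          unfolding N using eq[of "inv f v"] by (simp add: Aut_inv_right[OF f])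
        then have "f (inv f v) \<in> f ` N" by blast
        then show "v \<in> f ` N" by (simp add: Aut_inv_right[OF f])
      qed
    qed
    show "p \<in> N" if "(f ^^ Suc k) p = p" for k p
      unfolding N using periodic_orbit_finite[OF f that] by simp
    show "\<exists>v. (\<forall>w\<in>M. R w v \<longleftrightarrow> \<tau> w) \<and>
      (\<forall>w\<in>M. \<forall>k. (f ^^ k) w \<noteq> v \<and> (f ^^ k) v \<noteq> w) \<and> (R v (f v) \<longleftrightarrow> i)"
      if M: "finite M" for M \<tau>
    proof -
      obtain v where "realizes R M \<tau> v" "v \<notin> orbit_of_set f M" "R v (f v) \<longleftrightarrow> i"
        using star M unfolding star_property_def by blast
      then show ?thesis
        unfolding realizes_def orbit_of_set_eq[OF f] by blast
    qed
    show "h \<in> Aut R" if "h \<in> K" for h using that K_Aut by blast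
    show "h v = f v" if "h \<in> K" "v \<in> N" for h v using that assms(6) by blast
    show "finite ((\<lambda>h. h v) ` K)" for v
      by (rule compactin_Aut_finite[OF assms(5), of _ UNIV]) (simp_all add: openin_Aut_topology)
    show "finite ((\<lambda>h. inv h v) ` K)" for v
    proof (rule compactin_Aut_finite[OF assms(5), of _ UNIV])
      \<comment> \<open>Fixing the value of the inverse at \<open>v\<close> fixes a value of
        \<open>h\<close> itself, so these fibres are open as well.\<close>
      have "{h \<in> Aut R. inv h v = a} = {h \<in> Aut R. h a = v}" for a
        using Aut_inv_left[of _ R] Aut_inv_right[of _ R] by blast
      then show "openin (Aut_topology R) {h \<in> Aut R. inv h v = a}" for a
        by (simp add: openin_Aut_topology)
    qed simp
  qed
  obtain g \<phi> where g: "g \<in> Aut R" "\<forall>v\<in>N. g v = v"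
    and \<phi>: "\<forall>h\<in>K. \<phi> h \<in> Aut R \<and> (\<forall>v\<in>N. \<phi> h v = v) \<and> \<phi> h \<circ> h \<circ> g = f \<circ> \<phi> h"
    using conjugators_exist by blast
  \<comment> \<open>A translation by \<open>g\<close> on the right alone is enough, with
    \<open>inv (\<phi> h)\<close> as the conjugating element.\<close>
  have "id \<circ> h \<circ> g \<in> conjugacy_class R f" if h: "h \<in> K" for h
  proof -
    have \<phi>_h: "\<phi> h \<in> Aut R" "\<phi> h \<circ> h \<circ> g = f \<circ> \<phi> h" using \<phi> h by blast+
    have "h (g v) = inv (\<phi> h) (f (\<phi> h v))" for v
      using Aut_inv_left[OF \<phi>_h(1), of "h (g v)"] fun_cong[OF \<phi>_h(2), of v] by simp
    moreover have "inv (inv (\<phi> h)) = \<phi> h" using Aut_bij[OF \<phi>_h(1)] by (rule inv_inv_eq)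
    ultimately have "id \<circ> h \<circ> g = inv (\<phi> h) \<circ> f \<circ> inv (inv (\<phi> h))"
      by (simp add: fun_eq_iff)
    then show ?thesis using Aut_inv[OF \<phi>_h(1)] unfolding conjugacy_class_def by blast
  qed
  then have "(\<lambda>h. id \<circ> h \<circ> g) ` K \<subseteq> conjugacy_class R f" by blast
  moreover have "id \<in> Aut R" by (simp add: Aut_def)
  ultimately have "translatable_into R K (conjugacy_class R f)"
    using g(1) unfolding translatable_into_def by blast
  then show ?thesis using g \<phi> by blast
qed

end
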